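(* Fix an $\mathbf{FO}^2$ sentence $\Gamma$ in Scott normal form and a finite domain $\Delta=\{e_1,\dots,e_n\}$, $n\ge 1$. Let $\Phi_{\Gamma,\Delta}$ be the propositional grounding of $(\Gamma,\Delta)$. Then the Two-Stage Compilation algorithm (described in the context), run on $\Gamma$ and $\Delta$, outputs a d-DNNF circuit that encodes $\Phi_{\Gamma,\Delta}$.
   Context: Logic. First-order logic is function-free, constant-free and without equality. Vocabularies are finite, with predicates of arity 1 or 2, and domains are finite and non-empty. A sentence $\Gamma$ is in Scott normal form if $\Gamma=\forall x\forall y:\phi(x,y)\wedge\bigwedge_{k\in[m]}\forall x\exists y:\beta_k(x,y)$, where $\phi$ is quantifier-free with variables among $x,y$ and each $\beta_k(x,y)$ is a single binary atom. The grounding of $(\Gamma,\Delta)$ is the propositional formula obtained by instantiating all quantifiers over $\Delta$; its variables are the ground atoms over $\Delta$. Circuits. An NNF circuit is a labelled DAG with internal nodes $\wedge,\vee$, leaves that are literals (or the constants $\top,\bot$), and a unique output node. $\mathrm{var}(C)$ is the set of variables of $C$. It is decomposable if the children of each $\wedge$-node have pairwise disjoint variable sets. It is deterministic if the children of each $\vee$-node are pairwise inconsistent. A d-DNNF is a decomposable and deterministic NNF. A circuit encodes a formula if they have the same satisfying assignments. Types. A unary type $\tau$ is a maximally consistent set of literals over the atoms $P(x)$ ($P$ unary in $\Gamma$) and $R(x,x)$ ($R$ binary in $\Gamma$). A binary type $\pi$ is a maximally consistent set of literals over the atoms $R(x,y),R(y,x)$ ($R$ binary in $\Gamma$). Types are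 identified with the conjunctions $\tau(x)$, $\pi(x,y)$ of their literals. $\tau$ is valid if $\tau(x)\models\phi(x,x)$; $\mathcal U$ is the set of valid unary types. For $\tau,\tau'\in\mathcal U$, $\mathcal B(\tau,\tau')$ is the set of binary types $\pi$ with $\tau(x)\wedge\tau'(y)\wedge\pi(x,y)\models\phi(x,y)\wedge\phi(y,x)$. Algorithm. A context $\theta$ is the conjunction of the ground type formulas chosen so far along the current recursion branch. $\textsc{Extendable}(\theta)$ holds iff there is a model $\mathcal A$ over $\Delta$ with $\mathcal A\models\Gamma\wedge\theta$. $\textsc{Or}(S)$ and $\textsc{And}(S)$ create an $\vee$-node (resp. $\wedge$-node) with children $S$; empty $\textsc{Or}$ is $\bot$ and empty $\textsc{And}$ is $\top$. Two-Stage Compilation returns $\textsc{Stage-I}(1,\top)$, where: - $\textsc{Stage-I}(i,\theta)$: if $i=n+1$, return $\textsc{Stage-II}((1,2),\theta)$. Otherwise return $\textsc{Or}$ of the set of all nodes $\textsc{And}(\textsc{And}(\tau(e_i)),\textsc{Stage-I}(i+1,\theta\wedge\tau(e_i)))$, over all $\tau\in\mathcal U$ for which $\textsc{Extendable}(\theta\wedge\tau(e_i))$ holds, where $\textsc{And}(\tau(e_i))$ is the $\wedge$-node over the literals of $\tau(e_i)$. - $\textsc{Stage-II}((i,j),\theta)$: if $i=n$, return $\top$. Otherwise let $\tau_i,\tau_j$ be the unary types assigned to $e_i,e_j$ in $\theta$ and return $\textsc{Or}$ of the set of all nodes $\textsc{And}(\textsc{And}(\pi(e_i,e_j)),\textsc{Stage-II}(\mathrm{next}(i,j),\theta\wedge\pi(e_i,e_j)))$,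 over all $\pi\in\mathcal B(\tau_i,\tau_j)$ for which $\textsc{Extendable}(\theta\wedge\pi(e_i,e_j))$ holds. Here $\mathrm{next}(i,j)$ is the next pair in lexicographic order among pairs with $1\le i<j\le n$, i.e. $(i,j+1)$ if $j<n$ and $(i+1,i+2)$ if $j=n$ (so the pair $(n-1,n)$ is followed by a terminal call with first index $n$). *)

theory Defs
  imports Main "HOL-Library.FSet"
begin

section \<open>Two-variable first-order logic\<close>

datatype var = X | Y

text \<open>\<open>'t\<close> is the type of terms: \<open>var\<close> for first-order atoms, domain elements for ground atoms.\<close>

datatype (atom_unary_preds: 'u, atom_binary_preds: 'b, atom_terms: 't) atom =
  UAtom 'u 't | BAtom 'b 't 't

abbreviation inst :: "('s \<Rightarrow> 't) \<Rightarrow> ('u, 'b, 's) atom \<Rightarrow> ('u, 'b, 't) atom" where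
  "inst f \<equiv> map_atom id id f"

text \<open>The sets \<open>unary_preds \<psi>\<close> and \<open>binary_preds \<psi>\<close> of predicates occurring in \<open>\<psi>\<close> are
  generated by the datatype package.\<close>

datatype (unary_preds: 'u, binary_preds: 'b) fm =
    Atom "('u, 'b, var) atom"
  | Neg "('u, 'b) fm"
  | Conj "('u, 'b) fm list"
  | Disj "('u, 'b) fm list"
  | All var "('u, 'b) fm"
  | Ex var "('u, 'b) fm"

fun quantifier_free :: "('u, 'b) fm \<Rightarrow> bool" where
  "quantifier_free (Atom a) \<longleftrightarrow> True"
| "quantifier_free (Neg \<psi>) \<longleftrightarrow> quantifier_free \<psi>"
| "quantifier_free (Conj \<psi>s) \<longleftrightarrow> (\<forall>\<psi>\<in>set \<psi>s. quantifier_free \<psi>)"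
| "quantifier_free (Disj \<psi>s) \<longleftrightarrow> (\<forall>\<psi>\<in>set \<psi>s. quantifier_free \<psi>)"
| "quantifier_free (All v \<psi>) \<longleftrightarrow> False"
| "quantifier_free (Ex v \<psi>) \<longleftrightarrow> False"

text \<open>Simultaneous substitution of variables. It is not capture-avoiding and is used for
  quantifier-free formulas only.\<close>

fun rename :: "(var \<Rightarrow> var) \<Rightarrow> ('u, 'b) fm \<Rightarrow> ('u, 'b) fm" where
  "rename f (Atom a) = Atom (inst f a)"
| "rename f (Neg \<psi>) = Neg (rename f \<psi>)"
| "rename f (Conj \<psi>s) = Conj (map (rename f) \<psi>s)"
| "rename f (Disj \<psi>s) = Disj (map (rename f) \<psi>s)"
| "rename f (All v \<psi>) = All v (rename f \<psi>)"
| "rename f (Ex v \<psi>) = Ex v (rename f \<psi>)"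

record ('u, 'b, 'e) struct =
  universe :: "'e set"
  unary_rel :: "'u \<Rightarrow> 'e \<Rightarrow> bool"
  binary_rel :: "'b \<Rightarrow> 'e \<Rightarrow> 'e \<Rightarrow> bool"

fun atom_true :: "('u, 'b, 'e) struct \<Rightarrow> ('u, 'b, 'e) atom \<Rightarrow> bool" where
  "atom_true A (UAtom P d) \<longleftrightarrow> unary_rel A P d"
| "atom_true A (BAtom R d d') \<longleftrightarrow> binary_rel A R d d'"

fun sat :: "('u, 'b, 'e) struct \<Rightarrow> (var \<Rightarrow> 'e) \<Rightarrow> ('u, 'b) fm \<Rightarrow> bool" where
  "sat A \<sigma> (Atom a) \<longleftrightarrow> atom_true A (inst \<sigma> a)"
| "sat A \<sigma> (Neg \<psi>) \<longleftrightarrow> \<not> sat A \<sigma> \<psi>"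
| "sat A \<sigma> (Conj \<psi>s) \<longleftrightarrow> (\<forall>\<psi>\<in>set \<psi>s. sat A \<sigma> \<psi>)"
| "sat A \<sigma> (Disj \<psi>s) \<longleftrightarrow> (\<exists>\<psi>\<in>set \<psi>s. sat A \<sigma> \<psi>)"
| "sat A \<sigma> (All v \<psi>) \<longleftrightarrow> (\<forall>d\<in>universe A. sat A (\<sigma>(v := d)) \<psi>)"
| "sat A \<sigma> (Ex v \<psi>) \<longleftrightarrow> (\<exists>d\<in>universe A. sat A (\<sigma>(v := d)) \<psi>)"

definition models :: "('u, 'b, 'e) struct \<Rightarrow> ('u, 'b) fm \<Rightarrow> bool" where
  "models A \<psi> \<longleftrightarrow> (\<forall>\<sigma>. range \<sigma> \<subseteq> universe A \<longrightarrow> sat A \<sigma> \<psi>)"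

text \<open>The Scott normal form sentence with matrix \<open>\<phi>\<close> and existential atoms \<open>\<beta>s\<close>.\<close>

definition scott :: "('u, 'b) fm \<Rightarrow> ('u, 'b, var) atom list \<Rightarrow> ('u, 'b) fm" where
  "scott \<phi> \<beta>s = Conj (All X (All Y \<phi>) # map (\<lambda>\<beta>. All X (Ex Y (Atom \<beta>))) \<beta>s)"

definition binary_atom :: "('u, 'b, 't) atom \<Rightarrow> bool" where
  "binary_atom \<beta> \<longleftrightarrow> (\<exists>R s t. \<beta> = BAtom R s t)"


section \<open>Propositional formulas and grounding\<close>

datatype 'v pfm =
    PVar 'v
  | PNeg "'v pfm"
  | PConj "'v pfm list"
  | PDisj "'v pfm list"

fun prop_sat :: "('v \<Rightarrow> bool) \<Rightarrow> 'v pfm \<Rightarrow> bool" where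
  "prop_sat \<nu> (PVar a) \<longleftrightarrow> \<nu> a"
| "prop_sat \<nu> (PNeg F) \<longleftrightarrow> \<not> prop_sat \<nu> F"
| "prop_sat \<nu> (PConj Fs) \<longleftrightarrow> (\<forall>F\<in>set Fs. prop_sat \<nu> F)"
| "prop_sat \<nu> (PDisj Fs) \<longleftrightarrow> (\<exists>F\<in>set Fs. prop_sat \<nu> F)"

fun ground :: "'e list \<Rightarrow> (var \<Rightarrow> 'e) \<Rightarrow> ('u, 'b) fm \<Rightarrow> ('u, 'b, 'e) atom pfm" where
  "ground es \<sigma> (Atom a) = PVar (inst \<sigma> a)"
| "ground es \<sigma> (Neg \<psi>) = PNeg (ground es \<sigma> \<psi>)"
| "ground es \<sigma> (Conj \<psi>s) = PConj (map (ground es \<sigma>) \<psi>s)"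
| "ground es \<sigma> (Disj \<psi>s) = PDisj (map (ground es \<sigma>) \<psi>s)"
| "ground es \<sigma> (All v \<psi>) = PConj (map (\<lambda>d. ground es (\<sigma>(v := d)) \<psi>) es)"
| "ground es \<sigma> (Ex v \<psi>) = PDisj (map (\<lambda>d. ground es (\<sigma>(v := d)) \<psi>) es)"

text \<open>In a sentence every variable occurrence is bound, so the initial assignment is never read.\<close>

definition grounding :: "('u, 'b) fm \<Rightarrow> 'e list \<Rightarrow> ('u, 'b, 'e) atom pfm" where
  "grounding \<Gamma> es = ground es (\<lambda>_. undefined) \<Gamma>"

datatype 'v literal = PosLit (var_of: 'v) | NegLit (var_of: 'v)

fun lit_sat :: "('v \<Rightarrow> bool) \<Rightarrow> 'v literal \<Rightarrow> bool" where
  "lit_sat \<nu> (PosLit a) \<longleftrightarrow> \<nu> a"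
| "lit_sat \<nu> (NegLit a) \<longleftrightarrow> \<not> \<nu> a"


section \<open>NNF circuits\<close>

datatype 'v label = AndL | OrL | LitL "'v literal" | TopL | BotL

text \<open>Edges point from a gate to its children.\<close>

record ('n, 'v) circuit =
  nodes :: "'n set"
  edges :: "('n \<times> 'n) set"
  label :: "'n \<Rightarrow> 'v label"
  out_node :: 'n

definition children :: "('n, 'v) circuit \<Rightarrow> 'n \<Rightarrow> 'n set" where
  "children C v = edges C `` {v}"

text \<open>The last conjunct says that the output is the unique node without a parent; in a finite
  acyclic graph this entails that every node is reachable from it.\<close>

definition nnf :: "('n, 'v) circuit \<Rightarrow> bool" where
  "nnf C \<longleftrightarrow>
     finite (nodes C) \<and> edges C \<subseteq> nodes C \<times> nodes C \<and> acyclic (edges C) \<and>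
     (\<forall>v\<in>nodes C. children C v \<noteq> {} \<longleftrightarrow> label C v \<in> {AndL, OrL}) \<and>
     {v \<in> nodes C. \<forall>u. (u, v) \<notin> edges C} = {out_node C}"

definition vars :: "('n, 'v) circuit \<Rightarrow> 'n \<Rightarrow> 'v set" where
  "vars C v = {var_of l | l u. (v, u) \<in> (edges C)\<^sup>* \<and> label C u = LitL l}"

text \<open>Negation occurs at leaves only, so the value of a node can be defined as a least fixed
  point; on an acyclic circuit this is bottom-up evaluation.\<close>

inductive node_sat :: "('n, 'v) circuit \<Rightarrow> ('v \<Rightarrow> bool) \<Rightarrow> 'n \<Rightarrow> bool"
  for C :: "('n, 'v) circuit" and \<nu> :: "'v \<Rightarrow> bool" where
  top: "label C v = TopL \<Longrightarrow> node_sat C \<nu> v"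
| lit: "label C v = LitL l \<Longrightarrow> lit_sat \<nu> l \<Longrightarrow> node_sat C \<nu> v"
| conj: "label C v = AndL \<Longrightarrow> \<forall>w\<in>children C v. node_sat C \<nu> w \<Longrightarrow> node_sat C \<nu> v"
| disj: "label C v = OrL \<Longrightarrow> w \<in> children C v \<Longrightarrow> node_sat C \<nu> w \<Longrightarrow> node_sat C \<nu> v"

definition decomposable :: "('n, 'v) circuit \<Rightarrow> bool" where
  "decomposable C \<longleftrightarrow>
     (\<forall>v\<in>nodes C. label C v = AndL \<longrightarrow>
        pairwise (\<lambda>u w. vars C u \<inter> vars C w = {}) (children C v))"

definition deterministic :: "('n, 'v) circuit \<Rightarrow> bool" where
  "deterministic C \<longleftrightarrow>
     (\<forall>v\<in>nodes C. label C v = OrL \<longrightarrow>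
        pairwise (\<lambda>u w. \<not> (\<exists>\<nu>. node_sat C \<nu> u \<and> node_sat C \<nu> w)) (children C v))"

definition d_DNNF :: "('n, 'v) circuit \<Rightarrow> bool" where
  "d_DNNF C \<longleftrightarrow> nnf C \<and> decomposable C \<and> deterministic C"

definition encodes :: "('n, 'v) circuit \<Rightarrow> 'v pfm \<Rightarrow> bool" where
  "encodes C F \<longleftrightarrow> {\<nu>. node_sat C \<nu> (out_node C)} = {\<nu>. prop_sat \<nu> F}"


section \<open>Types\<close>

definition literals_over :: "'v set \<Rightarrow> 'v literal set" where
  "literals_over V = PosLit ` V \<union> NegLit ` V"

definition consistent :: "'v literal set \<Rightarrow> bool" where
  "consistent L \<longleftrightarrow> (\<nexists>a. PosLit a \<in> L \<and> NegLit a \<in> L)"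

definition max_consistent :: "'v set \<Rightarrow> 'v literal set \<Rightarrow> bool" where
  "max_consistent V L \<longleftrightarrow>
     L \<subseteq> literals_over V \<and> consistent L \<and>
     (\<forall>L'. L \<subseteq> L' \<and> L' \<subseteq> literals_over V \<and> consistent L' \<longrightarrow> L' = L)"

type_synonym ('u, 'b) ty = "('u, 'b, var) atom literal set"

definition unary_types :: "('u, 'b) fm \<Rightarrow> ('u, 'b) ty set" where
  "unary_types \<Gamma> =
     {\<tau>. max_consistent ((\<lambda>P. UAtom P X) ` unary_preds \<Gamma> \<union> (\<lambda>R. BAtom R X X) ` binary_preds \<Gamma>) \<tau>}"

definition binary_types :: "('u, 'b) fm \<Rightarrow> ('u, 'b) ty set" where
  "binary_types \<Gamma> =
     {\<pi>. max_consistent ((\<lambda>R. BAtom R X Y) ` binary_preds \<Gamma> \<union> (\<lambda>R. BAtom R Y X) ` binary_preds \<Gamma>) \<pi>}"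

definition inst_ty :: "(var \<Rightarrow> 't) \<Rightarrow> ('u, 'b) ty \<Rightarrow> ('u, 'b, 't) atom literal set" where
  "inst_ty f L = map_literal (inst f) ` L"

definition lits_true :: "('u, 'b, 'e) struct \<Rightarrow> ('u, 'b, 'e) atom literal set \<Rightarrow> bool" where
  "lits_true A L \<longleftrightarrow> (\<forall>l\<in>L. lit_sat (atom_true A) l)"

text \<open>First-order entailment from a conjunction of literals. Every finite structure is isomorphic
  to one whose universe is a set of natural numbers, which avoids quantifying over types.\<close>

definition entails :: "('u, 'b) ty \<Rightarrow> ('u, 'b) fm \<Rightarrow> bool" where
  "entails L \<psi> \<longleftrightarrow>
     (\<forall>(A :: ('u, 'b, nat) struct) \<sigma>.
        finite (universe A) \<and> universe A \<noteq> {} \<and> range \<sigma> \<subseteq> universe A \<and>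
        lits_true A (inst_ty \<sigma> L) \<longrightarrow> sat A \<sigma> \<psi>)"

fun swap_var :: "var \<Rightarrow> var" where
  "swap_var X = Y"
| "swap_var Y = X"

definition valid_types :: "('u, 'b) fm \<Rightarrow> ('u, 'b, var) atom list \<Rightarrow> ('u, 'b) ty set" where
  "valid_types \<phi> \<beta>s = {\<tau> \<in> unary_types (scott \<phi> \<beta>s). entails \<tau> (rename (\<lambda>_. X) \<phi>)}"

definition compatible_types ::
  "('u, 'b) fm \<Rightarrow> ('u, 'b, var) atom list \<Rightarrow> ('u, 'b) ty \<Rightarrow> ('u, 'b) ty \<Rightarrow> ('u, 'b) ty set" where
  "compatible_types \<phi> \<beta>s \<tau> \<tau>' =
     {\<pi> \<in> binary_types (scott \<phi> \<beta>s).
        entails (\<tau> \<union> inst_ty (\<lambda>_. Y) \<tau>' \<union> \<pi>) (Conj [\<phi>, rename swap_var \<phi>])}"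


section \<open>Contexts\<close>

text \<open>\<open>UTy \<tau> d\<close> stands for \<open>\<tau>(d)\<close> and \<open>BTy \<pi> d d'\<close> for \<open>\<pi>(d, d')\<close>; a context is the set of the
  conjuncts chosen so far, the empty set being the trivially true context.\<close>

datatype ('u, 'b, 'e) ground_type =
    UTy "('u, 'b) ty" 'e
  | BTy "('u, 'b) ty" 'e 'e

fun ground_lits :: "('u, 'b, 'e) ground_type \<Rightarrow> ('u, 'b, 'e) atom literal set" where
  "ground_lits (UTy \<tau> d) = inst_ty (\<lambda>_. d) \<tau>"
| "ground_lits (BTy \<pi> d d') = inst_ty (case_var d d') \<pi>"

type_synonym ('u, 'b, 'e) ctxt = "('u, 'b, 'e) ground_type set"

definition extendable :: "('u, 'b) fm \<Rightarrow> 'e list \<Rightarrow> ('u, 'b, 'e) ctxt \<Rightarrow> bool" where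
  "extendable \<Gamma> es \<theta> \<longleftrightarrow>
     (\<exists>A. universe A = set es \<and> models A \<Gamma> \<and> (\<forall>t\<in>\<theta>. lits_true A (ground_lits t)))"

definition assigned_type :: "('u, 'b, 'e) ctxt \<Rightarrow> 'e \<Rightarrow> ('u, 'b) ty" where
  "assigned_type \<theta> d = (THE \<tau>. UTy \<tau> d \<in> \<theta>)"


section \<open>Two-stage compilation\<close>

text \<open>The nodes created by the algorithm. A gate is identified by its kind and its set of
  children, so the circuit with output \<open>r\<close> is the graph of all nodes reachable from \<open>r\<close>, with
  common substructures shared.\<close>

datatype 'v node =
    LitN "'v literal"
  | TopN
  | BotN
  | AndN "'v node fset"
  | OrN "'v node fset"

fun node_children :: "'v node \<Rightarrow> 'v node set" where
  "node_children (AndN S) = fset S"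
| "node_children (OrN S) = fset S"
| "node_children _ = {}"

fun node_label :: "'v node \<Rightarrow> 'v label" where
  "node_label (LitN l) = LitL l"
| "node_label TopN = TopL"
| "node_label BotN = BotL"
| "node_label (AndN S) = AndL"
| "node_label (OrN S) = OrL"

definition circuit_of :: "'v node \<Rightarrow> ('v node, 'v) circuit" where
  "circuit_of r =
     (let N = {(u, v). v \<in> node_children u}\<^sup>* `` {r}
      in \<lparr>nodes = N, edges = {(u, v). u \<in> N \<and> v \<in> node_children u},
          label = node_label, out_node = r\<rparr>)"

text \<open>Applied to finite sets only, since \<open>Abs_fset\<close> is unspecified elsewhere.\<close>

definition mk_or :: "'v node set \<Rightarrow> 'v node" where
  "mk_or S = (if S = {} then BotN else OrN (Abs_fset S))"

definition mk_and :: "'v node set \<Rightarrow> 'v node" where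
  "mk_and S = (if S = {} then TopN else AndN (Abs_fset S))"

text \<open>Indices are 1-based, as in \<open>\<Delta> = {e\<^sub>1, \<dots>, e\<^sub>n}\<close>.\<close>

abbreviation elt :: "'e list \<Rightarrow> nat \<Rightarrow> 'e" where
  "elt es i \<equiv> es ! (i - 1)"

fun next_pair :: "nat \<Rightarrow> nat \<times> nat \<Rightarrow> nat \<times> nat" where
  "next_pair n (i, j) = (if j < n then (i, j + 1) else (i + 1, i + 2))"

text \<open>The tests \<open>i \<ge> n\<close> and \<open>i > n\<close> below make the functions total; the calls that arise satisfy
  \<open>i \<le> n\<close> and \<open>i \<le> n + 1\<close>, respectively, so they amount to \<open>i = n\<close> and \<open>i = n + 1\<close>.\<close>

function stage_II ::
  "('u, 'b) fm \<Rightarrow> ('u, 'b, var) atom list \<Rightarrow> 'e list \<Rightarrow> nat \<times> nat \<Rightarrow> ('u, 'b, 'e) ctxt \<Rightarrow>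
     ('u, 'b, 'e) atom node" where
  "stage_II \<phi> \<beta>s es (i, j) \<theta> =
     (if i \<ge> length es then TopN
      else mk_or
        ((\<lambda>\<pi>. mk_and
            {mk_and (LitN ` ground_lits (BTy \<pi> (elt es i) (elt es j))),
             stage_II \<phi> \<beta>s es (next_pair (length es) (i, j))
               (insert (BTy \<pi> (elt es i) (elt es j)) \<theta>)})
         ` {\<pi> \<in> compatible_types \<phi> \<beta>s
                  (assigned_type \<theta> (elt es i)) (assigned_type \<theta> (elt es j)).
              extendable (scott \<phi> \<beta>s) es (insert (BTy \<pi> (elt es i) (elt es j)) \<theta>)}))"
  by pat_completeness auto
termination
  by (relation "inv_image (less_than <*lex*> less_than)
        (\<lambda>(_, _, es, (i, j), _). (length es - i, length es - j))") auto

function stage_I ::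
  "('u, 'b) fm \<Rightarrow> ('u, 'b, var) atom list \<Rightarrow> 'e list \<Rightarrow> nat \<Rightarrow> ('u, 'b, 'e) ctxt \<Rightarrow>
     ('u, 'b, 'e) atom node" where
  "stage_I \<phi> \<beta>s es i \<theta> =
     (if i > length es then stage_II \<phi> \<beta>s es (1, 2) \<theta>
      else mk_or
        ((\<lambda>\<tau>. mk_and
            {mk_and (LitN ` ground_lits (UTy \<tau> (elt es i))),
             stage_I \<phi> \<beta>s es (i + 1) (insert (UTy \<tau> (elt es i)) \<theta>)})
         ` {\<tau> \<in> valid_types \<phi> \<beta>s.
              extendable (scott \<phi> \<beta>s) es (insert (UTy \<tau> (elt es i)) \<theta>)}))"
  by pat_completeness auto
termination
  by (relation "measure (\<lambda>(_, _, es, i, _). Suc (length es) - i)") auto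

declare stage_I.simps [simp del] stage_II.simps [simp del]

definition two_stage ::
  "('u, 'b) fm \<Rightarrow> ('u, 'b, var) atom list \<Rightarrow> 'e list \<Rightarrow>
     (('u, 'b, 'e) atom node, ('u, 'b, 'e) atom) circuit" where
  "two_stage \<phi> \<beta>s es = circuit_of (stage_I \<phi> \<beta>s es 1 {})"

end

theory Submission
  imports Defs
begin

text \<open>An assignment \<open>\<nu>\<close> satisfies a ground type exactly when that type is the one induced by \<open>\<nu>\<close>.
  Hence distinct branches of an \<open>\<or>\<close>-node are inconsistent, and at most one branch of the recursion
  survives under a given \<open>\<nu>\<close>, namely the one whose context consists of the types induced by \<open>\<nu>\<close>.
  If \<open>\<nu>\<close> describes a model, these types are valid and compatible and the model itself witnesses
  extendability, so the branch is never cut off. Conversely, a complete context fixes every ground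
  atom over the vocabulary, so a witness of its extendability agrees with \<open>\<nu>\<close>, and \<open>\<nu>\<close> describes
  a model.\<close>

section \<open>Circuits represented by nodes\<close>

text \<open>The recursive calls go through \<open>fimage\<close> because primitive recursion on a
  datatype nested in \<open>fset\<close> admits them only under its map function.\<close>

primrec holds :: "('v \<Rightarrow> bool) \<Rightarrow> 'v node \<Rightarrow> bool" where
  "holds \<nu> (LitN l) = lit_sat \<nu> l"
| "holds \<nu> TopN = True"
| "holds \<nu> BotN = False"
| "holds \<nu> (AndN S) = fBall (fimage (holds \<nu>) S) (\<lambda>b. b)"
| "holds \<nu> (OrN S) = fBex (fimage (holds \<nu>) S) (\<lambda>b. b)"

text \<open>The d-DNNF conditions read off the term, so that they can be proved along the recursion
  that builds it. Gates must be nonempty because \<open>nnf\<close> makes the gates exactly the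
  nodes with children. \<open>set_node\<close> is the variable set generated with the
  datatype.\<close>

inductive ddnnf_node :: "'v node \<Rightarrow> bool" where
  Lit: "ddnnf_node (LitN l)"
| Top: "ddnnf_node TopN"
| Bot: "ddnnf_node BotN"
| And: "S \<noteq> {||} \<Longrightarrow> (\<And>u. u \<in> fset S \<Longrightarrow> ddnnf_node u) \<Longrightarrow>
    pairwise (\<lambda>u w. set_node u \<inter> set_node w = {}) (fset S) \<Longrightarrow> ddnnf_node (AndN S)"
| Or: "S \<noteq> {||} \<Longrightarrow> (\<And>u. u \<in> fset S \<Longrightarrow> ddnnf_node u) \<Longrightarrow>
    pairwise (\<lambda>u w. \<not> (\<exists>\<nu>. holds \<nu> u \<and> holds \<nu> w)) (fset S) \<Longrightarrow> ddnnf_node (OrN S)"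

section \<open>Reachability between nodes and the passage from terms to circuits\<close>

definition child_rel :: "('v node \<times> 'v node) set" where
  "child_rel = {(u, v). v \<in> node_children u}"

text \<open>Children are proper subterms, so structural induction yields induction along this
  relation; finiteness and acyclicity of the circuit follow from it.\<close>

lemma wf_child_rel: "wf (child_rel\<inverse>)"
proof (rule wfUNIVI)
  fix P :: "'v node \<Rightarrow> bool" and x
  assume step: "\<forall>x. (\<forall>y. (y, x) \<in> child_rel\<inverse> \<longrightarrow> P y) \<longrightarrow> P x"
  show "P x"
    by (induction x) (rule step[rule_format]; auto simp: child_rel_def)+
qed

lemma descendant_iff:
  "(u, w) \<in> child_rel\<^sup>* \<longleftrightarrow> w = u \<or> (\<exists>v\<in>node_children u. (v, w) \<in> child_rel\<^sup>*)"
  by (auto simp: child_rel_def elim: converse_rtranclE intro: converse_rtrancl_into_rtrancl)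

lemma finite_descendants: "finite (child_rel\<^sup>* `` {u})"
proof (induction u rule: wf_induct_rule[OF wf_child_rel])
  case (1 u)
  have "child_rel\<^sup>* `` {u} = insert u (\<Union>v\<in>node_children u. child_rel\<^sup>* `` {v})"
    using descendant_iff[of u] by blast
  moreover have "finite (node_children u)" by (cases u) auto
  ultimately show ?case using 1 by (simp add: child_rel_def)
qed

text \<open>Connects the generated variable set with reachability, by which \<open>vars\<close> is
  defined.\<close>

lemma set_node_descendants: "set_node u = {var_of l | l. (u, LitN l) \<in> child_rel\<^sup>*}"
proof (induction u)
  case (LitN l)
  have "(LitN l, LitN l') \<in> child_rel\<^sup>* \<longleftrightarrow> l' = l" for l' by (subst descendant_iff) simp
  then show ?case by (cases l) simp_all
next
  case TopN
  have "(TopN, LitN l :: 'a node) \<notin> child_rel\<^sup>*" for l by (subst descendant_iff) simp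
  then show ?case by simp
next
  case BotN
  have "(BotN, LitN l :: 'a node) \<notin> child_rel\<^sup>*" for l by (subst descendant_iff) simp
  then show ?case by simp
next
  case (AndN S)
  have "(AndN S, LitN l) \<in> child_rel\<^sup>* \<longleftrightarrow> (\<exists>v\<in>fset S. (v, LitN l) \<in> child_rel\<^sup>*)" for l
    by (subst descendant_iff) simp
  with AndN show ?case by auto
next
  case (OrN S)
  have "(OrN S, LitN l) \<in> child_rel\<^sup>* \<longleftrightarrow> (\<exists>v\<in>fset S. (v, LitN l) \<in> child_rel\<^sup>*)" for l
    by (subst descendant_iff) simp
  with OrN show ?case by auto
qed

lemma circuit_of_sel:
  "nodes (circuit_of r) = child_rel\<^sup>* `` {r}"
  "edges (circuit_of r) = {(u, v). (r, u) \<in> child_rel\<^sup>* \<and> v \<in> node_children u}"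
  "label (circuit_of r) = node_label"
  "out_node (circuit_of r) = r"
  by (simp_all add: circuit_of_def child_rel_def Let_def)

lemma children_circuit_of: "(r, u) \<in> child_rel\<^sup>* \<Longrightarrow> children (circuit_of r) u = node_children u"
  by (auto simp: children_def circuit_of_sel)

lemma descendant_child:
  "(r, u) \<in> child_rel\<^sup>* \<Longrightarrow> v \<in> node_children u \<Longrightarrow> (r, v) \<in> child_rel\<^sup>*"
  by (auto simp: child_rel_def intro: rtrancl_into_rtrancl)

text \<open>Below the root a node has the same children in the circuit as in the term, so unfolding
  the least fixed point once per node reproduces the recursion of \<open>holds\<close>.\<close>

lemma node_sat_circuit_of:
  "(r, u) \<in> child_rel\<^sup>* \<Longrightarrow> node_sat (circuit_of r) \<nu> u \<longleftrightarrow> holds \<nu> u"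
proof (induction u)
  case (AndN S)
  have "node_sat (circuit_of r) \<nu> (AndN S) \<longleftrightarrow> (\<forall>w\<in>fset S. node_sat (circuit_of r) \<nu> w)"
    using children_circuit_of[OF AndN.prems]
    by (subst node_sat.simps) (auto simp: circuit_of_sel)
  with AndN.IH descendant_child[OF AndN.prems] show ?case by auto
next
  case (OrN S)
  have "node_sat (circuit_of r) \<nu> (OrN S) \<longleftrightarrow> (\<exists>w\<in>fset S. node_sat (circuit_of r) \<nu> w)"
    using children_circuit_of[OF OrN.prems]
    by (subst node_sat.simps) (auto simp: circuit_of_sel)
  with OrN.IH descendant_child[OF OrN.prems] show ?case by auto
qed (subst node_sat.simps; simp add: circuit_of_sel)+

lemma vars_circuit_of:
  assumes "(r, u) \<in> child_rel\<^sup>*"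
  shows "vars (circuit_of r) u = set_node u"
proof -
  \<comment> \<open>The edges are the child pairs whose source is reachable from \<open>r\<close>,
    and a path starting at a reachable node never leaves this region.\<close>
  have "(u, w) \<in> (edges (circuit_of r))\<^sup>* \<longleftrightarrow> (u, w) \<in> child_rel\<^sup>*" for w
  proof
    assume "(u, w) \<in> (edges (circuit_of r))\<^sup>*"
    then show "(u, w) \<in> child_rel\<^sup>*"
      by (rule rtrancl_mono[THEN subsetD, rotated]) (auto simp: circuit_of_sel child_rel_def)
  next
    assume "(u, w) \<in> child_rel\<^sup>*"
    then show "(u, w) \<in> (edges (circuit_of r))\<^sup>*"
    proof (induction rule: rtrancl_induct)
      case (step v w)
      then have "(v, w) \<in> edges (circuit_of r)"
        using assms by (auto simp: circuit_of_sel child_rel_def)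
      with step.IH show ?case by (rule rtrancl_into_rtrancl)
    qed simp
  qed
  moreover have "node_label v = LitL l \<longleftrightarrow> v = LitN l" for v :: "'a node" and l
    by (cases v) auto
  ultimately show ?thesis
    by (auto simp: vars_def set_node_descendants circuit_of_sel)
qed

lemma ddnnf_node_descendant:
  assumes "(r, u) \<in> child_rel\<^sup>*" "ddnnf_node r"
  shows "ddnnf_node u"
  using assms
proof (induction rule: rtrancl_induct)
  case (step v w)
  from step.IH[OF step.prems] step.hyps(2) show ?case
    by (cases rule: ddnnf_node.cases) (auto simp: child_rel_def)
qed

lemma nnf_circuit_of:
  assumes "ddnnf_node r"
  shows "nnf (circuit_of r)"
proof -
  have "acyclic (child_rel :: ('a node \<times> 'a node) set)"
    using wf_acyclic[OF wf_child_rel] by simp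
  then have acyc: "acyclic (edges (circuit_of r))"
    by (rule acyclic_subset) (auto simp: circuit_of_sel child_rel_def)
  have "node_children v \<noteq> {} \<longleftrightarrow> node_label v \<in> {AndL, OrL}" if "(r, v) \<in> child_rel\<^sup>*" for v
    using ddnnf_node_descendant[OF that assms] by cases auto
  \<comment> \<open>The output is the only node without a parent: a parent of \<open>r\<close> would
    close a cycle, and every other node is entered by the last edge of a path from
    \<open>r\<close>.\<close>
  moreover have "(u, r) \<notin> edges (circuit_of r)" for u
  proof
    assume "(u, r) \<in> edges (circuit_of r)"
    then have "(r, u) \<in> child_rel\<^sup>*" "(u, r) \<in> child_rel" by (auto simp: circuit_of_sel child_rel_def)
    then have "(r, r) \<in> child_rel\<^sup>+" by (rule rtrancl_into_trancl1)
    with \<open>acyclic child_rel\<close> show False by (auto simp: acyclic_def)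
  qed
  moreover have "\<exists>u. (u, v) \<in> edges (circuit_of r)" if "(r, v) \<in> child_rel\<^sup>*" "v \<noteq> r" for v
    using that by (auto simp: circuit_of_sel child_rel_def elim: rtranclE)
  ultimately show ?thesis
    using acyc finite_descendants[of r] descendant_child[of r]
    by (fastforce simp: nnf_def circuit_of_sel children_circuit_of)
qed

lemma d_DNNF_circuit_of:
  assumes "ddnnf_node r"
  shows "d_DNNF (circuit_of r)"
proof -
  have "pairwise (\<lambda>u w. vars (circuit_of r) u \<inter> vars (circuit_of r) w = {})
      (children (circuit_of r) v)"
    if v: "(r, v) \<in> child_rel\<^sup>*" and "node_label v = AndL" for v
  proof -
    from ddnnf_node_descendant[OF v assms] that(2)
    have "pairwise (\<lambda>u w. set_node u \<inter> set_node w = {}) (node_children v)" by cases auto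
    then show ?thesis
      by (simp add: pairwise_def children_circuit_of[OF v] vars_circuit_of[OF descendant_child[OF v]])
  qed
  moreover have "pairwise (\<lambda>u w. \<not> (\<exists>\<nu>. node_sat (circuit_of r) \<nu> u \<and> node_sat (circuit_of r) \<nu> w))
      (children (circuit_of r) v)"
    if v: "(r, v) \<in> child_rel\<^sup>*" and "node_label v = OrL" for v
  proof -
    from ddnnf_node_descendant[OF v assms] that(2)
    have "pairwise (\<lambda>u w. \<not> (\<exists>\<nu>. holds \<nu> u \<and> holds \<nu> w)) (node_children v)" by cases auto
    then show ?thesis
      by (simp add: pairwise_def children_circuit_of[OF v]
          node_sat_circuit_of[OF descendant_child[OF v]])
  qed
  ultimately show ?thesis
    using nnf_circuit_of[OF assms]
    by (simp add: d_DNNF_def decomposable_def deterministic_def circuit_of_sel)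
qed

text \<open>For empty \<open>S\<close> the constants \<open>TopN\<close> and \<open>BotN\<close>
  have the values of the empty conjunction and disjunction, so gates and constants need no separate
  treatment later.\<close>

lemma
  assumes "finite S"
  shows holds_mk_and: "holds \<nu> (mk_and S) \<longleftrightarrow> (\<forall>u\<in>S. holds \<nu> u)"
    and holds_mk_or: "holds \<nu> (mk_or S) \<longleftrightarrow> (\<exists>u\<in>S. holds \<nu> u)"
    and set_node_mk_and: "set_node (mk_and S) = \<Union> (set_node ` S)"
    and set_node_mk_or: "set_node (mk_or S) = \<Union> (set_node ` S)"
  using assms by (auto simp: mk_and_def mk_or_def Abs_fset_inverse)

lemma Abs_fset_nonempty: "finite S \<Longrightarrow> S \<noteq> {} \<Longrightarrow> Abs_fset S \<noteq> {||}"
  by (metis Abs_fset_inverse bot_fset.rep_eq mem_Collect_eq)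

lemma ddnnf_node_mk_and:
  assumes "finite S" "\<And>u. u \<in> S \<Longrightarrow> ddnnf_node u"
    "pairwise (\<lambda>u w. set_node u \<inter> set_node w = {}) S"
  shows "ddnnf_node (mk_and S)"
  using assms by (auto simp: mk_and_def Abs_fset_inverse Abs_fset_nonempty intro!: ddnnf_node.intros)

lemma ddnnf_node_mk_or:
  assumes "finite S" "\<And>u. u \<in> S \<Longrightarrow> ddnnf_node u"
    "pairwise (\<lambda>u w. \<not> (\<exists>\<nu>. holds \<nu> u \<and> holds \<nu> w)) S"
  shows "ddnnf_node (mk_or S)"
  using assms by (auto simp: mk_or_def Abs_fset_inverse Abs_fset_nonempty intro!: ddnnf_node.intros)


section \<open>Types induced by an assignment\<close>

definition induced_type :: "'v set \<Rightarrow> ('v \<Rightarrow> bool) \<Rightarrow> 'v literal set" where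
  "induced_type V \<mu> = {l \<in> literals_over V. lit_sat \<mu> l}"

lemma mem_literals_over [simp]: "l \<in> literals_over V \<longleftrightarrow> var_of l \<in> V"
  by (cases l) (auto simp: literals_over_def)

lemma max_consistentD:
  assumes "max_consistent V L"
  shows "l \<in> L \<Longrightarrow> var_of l \<in> V" "PosLit a \<in> L \<Longrightarrow> NegLit a \<notin> L"
    and "L \<subseteq> L' \<Longrightarrow> L' \<subseteq> literals_over V \<Longrightarrow> consistent L' \<Longrightarrow> L' = L"
proof -
  have L: "L \<subseteq> literals_over V" "consistent L" using assms unfolding max_consistent_def by simp_all
  show "l \<in> L \<Longrightarrow> var_of l \<in> V" using L(1) by auto
  show "PosLit a \<in> L \<Longrightarrow> NegLit a \<notin> L" using L(2) by (auto simp: consistent_def)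
  show "L \<subseteq> L' \<Longrightarrow> L' \<subseteq> literals_over V \<Longrightarrow> consistent L' \<Longrightarrow> L' = L"
    using assms unfolding max_consistent_def by simp
qed

text \<open>A literal over \<open>V\<close> that is false under \<open>\<mu>\<close> has its
  complement in the induced type, so no consistent extension can contain it.\<close>

lemma max_consistent_induced_type: "max_consistent V (induced_type V \<mu>)"
proof -
  have "L' = induced_type V \<mu>"
    if sub: "induced_type V \<mu> \<subseteq> L'" "L' \<subseteq> literals_over V" and con: "consistent L'" for L'
  proof (intro equalityI subsetI)
    fix l assume l: "l \<in> L'"
    with sub(2) have V: "var_of l \<in> V" by auto
    show "l \<in> induced_type V \<mu>"
    proof (cases l)
      case (PosLit a)
      with l con have "NegLit a \<notin> induced_type V \<mu>" using sub(1) unfolding consistent_def by blast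
      with PosLit V show ?thesis by (simp add: induced_type_def)
    next
      case (NegLit a)
      with l con have "PosLit a \<notin> induced_type V \<mu>" using sub(1) unfolding consistent_def by blast
      with NegLit V show ?thesis by (simp add: induced_type_def)
    qed
  qed (use sub(1) in blast)
  moreover have "induced_type V \<mu> \<subseteq> literals_over V" "consistent (induced_type V \<mu>)"
    by (auto simp: consistent_def induced_type_def)
  ultimately show ?thesis unfolding max_consistent_def by blast
qed

text \<open>A satisfied \<open>L\<close> lies inside the induced type, which is itself consistent
  over \<open>V\<close>; maximality of \<open>L\<close> forces equality.\<close>

lemma lits_sat_iff_induced_type:
  assumes "max_consistent V L"
  shows "(\<forall>l\<in>L. lit_sat \<mu> l) \<longleftrightarrow> L = induced_type V \<mu>"
proof
  assume "\<forall>l\<in>L. lit_sat \<mu> l"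
  then have "L \<subseteq> induced_type V \<mu>"
    using max_consistentD(1)[OF assms] by (auto simp: induced_type_def)
  then have "induced_type V \<mu> = L"
    by (rule max_consistentD(3)[OF assms]) (auto simp: induced_type_def consistent_def)
  then show "L = induced_type V \<mu>" by simp
qed (simp add: induced_type_def)

lemma induced_type_eq_iff: "induced_type V \<mu> = induced_type V \<mu>' \<longleftrightarrow> (\<forall>a\<in>V. \<mu> a = \<mu>' a)"
proof
  assume eq: "induced_type V \<mu> = induced_type V \<mu>'"
  show "\<forall>a\<in>V. \<mu> a = \<mu>' a"
  proof
    fix a assume "a \<in> V"
    then have "PosLit a \<in> induced_type V \<mu> \<longleftrightarrow> \<mu> a" "PosLit a \<in> induced_type V \<mu>' \<longleftrightarrow> \<mu>' a"
      by (auto simp: induced_type_def)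
    with eq show "\<mu> a = \<mu>' a" by simp
  qed
next
  assume "\<forall>a\<in>V. \<mu> a = \<mu>' a"
  then have "lit_sat \<mu> l = lit_sat \<mu>' l" if "var_of l \<in> V" for l
    using that by (cases l) auto
  then show "induced_type V \<mu> = induced_type V \<mu>'" by (auto simp: induced_type_def)
qed

lemma var_of_map_literal [simp]: "var_of (map_literal f l) = f (var_of l)"
  by (cases l) auto

lemma set_literal_eq [simp]: "set_literal l = {var_of l}"
  by (cases l) auto

lemma lit_sat_map_literal: "lit_sat \<nu> (map_literal f l) \<longleftrightarrow> lit_sat (\<nu> \<circ> f) l"
  by (cases l) auto

lemma finite_literals_over: "finite V \<Longrightarrow> finite (literals_over V)"
  by (simp add: literals_over_def)

lemma max_consistent_finite:
  assumes "finite V" "max_consistent V L"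
  shows "finite L"
proof (rule finite_subset)
  show "L \<subseteq> literals_over V" using max_consistentD(1)[OF assms(2)] by auto
qed (rule finite_literals_over[OF assms(1)])

lemma finite_max_consistent:
  assumes "finite V"
  shows "finite {L. max_consistent V L}"
  using finite_literals_over[OF assms]
  by (rule finite_subset[rotated, OF finite_Pow_iff[THEN iffD2]]) (auto dest: max_consistentD(1))

section \<open>Types induced at elements and at pairs of elements\<close>

abbreviation unary_atoms :: "('u, 'b) fm \<Rightarrow> ('u, 'b, var) atom set" where
  "unary_atoms \<Gamma> \<equiv> (\<lambda>P. UAtom P X) ` unary_preds \<Gamma> \<union> (\<lambda>R. BAtom R X X) ` binary_preds \<Gamma>"

abbreviation binary_atoms :: "('u, 'b) fm \<Rightarrow> ('u, 'b, var) atom set" where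
  "binary_atoms \<Gamma> \<equiv> (\<lambda>R. BAtom R X Y) ` binary_preds \<Gamma> \<union> (\<lambda>R. BAtom R Y X) ` binary_preds \<Gamma>"

text \<open>Pulling \<open>\<nu>\<close> back along the instantiation gives a type in the variable
  \<open>X\<close>, so types at different elements, even of different domains, can be
  compared.\<close>

definition unary_type_at ::
  "('u, 'b) fm \<Rightarrow> (('u, 'b, 'e) atom \<Rightarrow> bool) \<Rightarrow> 'e \<Rightarrow> ('u, 'b) ty" where
  "unary_type_at \<Gamma> \<nu> d = induced_type (unary_atoms \<Gamma>) (\<nu> \<circ> inst (\<lambda>_. d))"

definition binary_type_at ::
  "('u, 'b) fm \<Rightarrow> (('u, 'b, 'e) atom \<Rightarrow> bool) \<Rightarrow> 'e \<Rightarrow> 'e \<Rightarrow> ('u, 'b) ty" where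
  "binary_type_at \<Gamma> \<nu> d d' = induced_type (binary_atoms \<Gamma>) (\<nu> \<circ> inst (case_var d d'))"

lemma finite_atom_preds: "finite (atom_unary_preds a)" "finite (atom_binary_preds a)"
  by (cases a; simp)+

lemma finite_preds: "finite (unary_preds \<psi>)" "finite (binary_preds \<psi>)"
  by (induction \<psi>) (auto simp: finite_atom_preds)

text \<open>Gates are formed with \<open>Abs_fset\<close>, which is specified on finite sets only;
  this finiteness makes the \<open>\<or>\<close>-gates of both stages meaningful.\<close>

lemma finite_types: "finite (unary_types \<Gamma>)" "finite (binary_types \<Gamma>)"
  by (simp_all add: unary_types_def binary_types_def finite_max_consistent finite_preds)

lemma finite_ground_lits:
  "\<tau> \<in> unary_types \<Gamma> \<Longrightarrow> finite (ground_lits (UTy \<tau> d))"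
  "\<pi> \<in> binary_types \<Gamma> \<Longrightarrow> finite (ground_lits (BTy \<pi> d d'))"
  by (auto simp: unary_types_def binary_types_def inst_ty_def finite_preds
      dest: max_consistent_finite[rotated] intro!: finite_imageI)

lemma type_at_mem:
  "unary_type_at \<Gamma> \<nu> d \<in> unary_types \<Gamma>" "binary_type_at \<Gamma> \<nu> d d' \<in> binary_types \<Gamma>"
  by (simp_all add: unary_types_def binary_types_def unary_type_at_def binary_type_at_def
      max_consistent_induced_type)

text \<open>Entailment instantiates unary types by assignments that may differ at \<open>X\<close>
  and \<open>Y\<close>, hence the general \<open>\<sigma>\<close>. Atoms of a unary type mention
  \<open>X\<close> alone, so only \<open>\<sigma> X\<close> matters.\<close>

lemma unary_inst_lits_sat_iff:
  assumes "\<tau> \<in> unary_types \<Gamma>"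
  shows "(\<forall>l\<in>inst_ty \<sigma> \<tau>. lit_sat \<nu> l) \<longleftrightarrow> \<tau> = unary_type_at \<Gamma> \<nu> (\<sigma> X)"
proof -
  have "(\<forall>l\<in>inst_ty \<sigma> \<tau>. lit_sat \<nu> l) \<longleftrightarrow> \<tau> = induced_type (unary_atoms \<Gamma>) (\<nu> \<circ> inst \<sigma>)"
    using assms by (simp add: unary_types_def inst_ty_def lit_sat_map_literal lits_sat_iff_induced_type)
  moreover have "induced_type (unary_atoms \<Gamma>) (\<nu> \<circ> inst \<sigma>) = unary_type_at \<Gamma> \<nu> (\<sigma> X)"
    by (simp add: unary_type_at_def induced_type_eq_iff ball_Un)
  ultimately show ?thesis by simp
qed

lemma binary_inst_lits_sat_iff:
  assumes "\<pi> \<in> binary_types \<Gamma>"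
  shows "(\<forall>l\<in>inst_ty \<sigma> \<pi>. lit_sat \<nu> l) \<longleftrightarrow> \<pi> = binary_type_at \<Gamma> \<nu> (\<sigma> X) (\<sigma> Y)"
proof -
  have "(\<forall>l\<in>inst_ty \<sigma> \<pi>. lit_sat \<nu> l) \<longleftrightarrow> \<pi> = induced_type (binary_atoms \<Gamma>) (\<nu> \<circ> inst \<sigma>)"
    using assms by (simp add: binary_types_def inst_ty_def lit_sat_map_literal lits_sat_iff_induced_type)
  moreover have "induced_type (binary_atoms \<Gamma>) (\<nu> \<circ> inst \<sigma>) = binary_type_at \<Gamma> \<nu> (\<sigma> X) (\<sigma> Y)"
    by (simp add: binary_type_at_def induced_type_eq_iff ball_Un)
  ultimately show ?thesis by simp
qed

text \<open>\<open>A\<close> and \<open>\<nu>\<close> may live on different domains. This carries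
  types realised in the given domain over to the structures on \<open>nat\<close> in
  \<open>entails\<close>.\<close>

lemma lits_true_type_at:
  "lits_true A (inst_ty \<sigma> (unary_type_at \<Gamma> \<nu> d)) \<longleftrightarrow>
    unary_type_at \<Gamma> \<nu> d = unary_type_at \<Gamma> (atom_true A) (\<sigma> X)"
  "lits_true A (inst_ty \<sigma> (binary_type_at \<Gamma> \<nu> c d)) \<longleftrightarrow>
    binary_type_at \<Gamma> \<nu> c d = binary_type_at \<Gamma> (atom_true A) (\<sigma> X) (\<sigma> Y)"
  unfolding lits_true_def
  by (rule unary_inst_lits_sat_iff[OF type_at_mem(1)] binary_inst_lits_sat_iff[OF type_at_mem(2)])+

lemma
  shows unary_lits_sat_iff: "\<tau> \<in> unary_types \<Gamma> \<Longrightarrow>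
      (\<forall>l\<in>ground_lits (UTy \<tau> d). lit_sat \<nu> l) \<longleftrightarrow> \<tau> = unary_type_at \<Gamma> \<nu> d"
    and binary_lits_sat_iff: "\<pi> \<in> binary_types \<Gamma> \<Longrightarrow>
      (\<forall>l\<in>ground_lits (BTy \<pi> c d). lit_sat \<nu> l) \<longleftrightarrow> \<pi> = binary_type_at \<Gamma> \<nu> c d"
  by (simp_all add: unary_inst_lits_sat_iff binary_inst_lits_sat_iff)

lemma unary_type_at_eq_iff:
  "unary_type_at \<Gamma> \<nu> d = unary_type_at \<Gamma> \<nu>' d' \<longleftrightarrow>
    (\<forall>P\<in>unary_preds \<Gamma>. \<nu> (UAtom P d) = \<nu>' (UAtom P d')) \<and>
    (\<forall>R\<in>binary_preds \<Gamma>. \<nu> (BAtom R d d) = \<nu>' (BAtom R d' d'))"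
  by (simp add: unary_type_at_def induced_type_eq_iff ball_Un)

lemma binary_type_at_eq_iff:
  "binary_type_at \<Gamma> \<nu> c d = binary_type_at \<Gamma> \<nu>' c' d' \<longleftrightarrow>
    (\<forall>R\<in>binary_preds \<Gamma>. \<nu> (BAtom R c d) = \<nu>' (BAtom R c' d') \<and>
      \<nu> (BAtom R d c) = \<nu>' (BAtom R d' c'))"
  by (simp add: binary_type_at_def induced_type_eq_iff ball_Un ball_conj_distrib)

text \<open>The set of elements in a ground atom serves as a key telling which recursive call
  introduced it; decomposability rests on these keys being distinct.\<close>

lemma atom_terms_unary_lits:
  "\<tau> \<in> unary_types \<Gamma> \<Longrightarrow> l \<in> ground_lits (UTy \<tau> d) \<Longrightarrow> atom_terms (var_of l) = {d}"
  by (auto simp: unary_types_def inst_ty_def dest!: max_consistentD(1))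

lemma atom_terms_binary_lits:
  "\<pi> \<in> binary_types \<Gamma> \<Longrightarrow> l \<in> ground_lits (BTy \<pi> d d') \<Longrightarrow> atom_terms (var_of l) = {d, d'}"
  by (auto simp: binary_types_def inst_ty_def dest!: max_consistentD(1))


section \<open>Models as assignments\<close>

definition struct_of :: "'e set \<Rightarrow> (('u, 'b, 'e) atom \<Rightarrow> bool) \<Rightarrow> ('u, 'b, 'e) struct" where
  "struct_of U \<nu> = \<lparr>universe = U, unary_rel = (\<lambda>P d. \<nu> (UAtom P d)),
     binary_rel = (\<lambda>R d d'. \<nu> (BAtom R d d'))\<rparr>"

lemma universe_struct_of [simp]: "universe (struct_of U \<nu>) = U"
  by (simp add: struct_of_def)

lemma atom_true_struct_of [simp]: "atom_true (struct_of U \<nu>) = \<nu>"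
proof
  show "atom_true (struct_of U \<nu>) a = \<nu> a" for a by (cases a) (auto simp: struct_of_def)
qed

lemma prop_sat_ground: "prop_sat \<nu> (ground es \<sigma> \<psi>) \<longleftrightarrow> sat (struct_of (set es) \<nu>) \<sigma> \<psi>"
  by (induction \<psi> arbitrary: \<sigma>) auto

lemma sat_scott:
  assumes "\<forall>\<beta>\<in>set \<beta>s. binary_atom \<beta>"
  shows "sat A \<sigma> (scott \<phi> \<beta>s) \<longleftrightarrow>
    (\<forall>c\<in>universe A. \<forall>d\<in>universe A. sat A (case_var c d) \<phi>) \<and>
    (\<forall>\<beta>\<in>set \<beta>s. \<forall>c\<in>universe A. \<exists>d\<in>universe A. atom_true A (inst (case_var c d) \<beta>))"
proof -
  have "\<sigma>(X := c, Y := d) = case_var c d" for c d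
    by (rule ext) (auto split: var.split)
  then show ?thesis by (simp add: scott_def)
qed

text \<open>\<open>models\<close> quantifies over assignments into the universe, whereas
  \<open>grounding\<close> starts from an unspecified one. The truth condition in
  \<open>sat_scott\<close> does not mention \<open>\<sigma>\<close>, and a nonempty universe
  provides some admissible assignment.\<close>

lemma models_scott:
  assumes "\<forall>\<beta>\<in>set \<beta>s. binary_atom \<beta>" "universe A \<noteq> {}"
  shows "models A (scott \<phi> \<beta>s) \<longleftrightarrow> sat A \<sigma> (scott \<phi> \<beta>s)"
proof -
  from assms(2) obtain d where "d \<in> universe A" by auto
  then have "range (\<lambda>_ :: var. d) \<subseteq> universe A" by auto
  then show ?thesis unfolding models_def sat_scott[OF assms(1)] by blast
qed

lemma models_scott_matrix:
  assumes "\<forall>\<beta>\<in>set \<beta>s. binary_atom \<beta>" "models A (scott \<phi> \<beta>s)" "c \<in> universe A" "d \<in> universe A"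
  shows "sat A (case_var c d) \<phi>"
proof -
  have "range (\<lambda>_ :: var. c) \<subseteq> universe A" using assms(3) by auto
  with assms(2) have "sat A (\<lambda>_. c) (scott \<phi> \<beta>s)" unfolding models_def by blast
  with assms(3,4) show ?thesis unfolding sat_scott[OF assms(1)] by blast
qed

lemma prop_sat_grounding:
  assumes "\<forall>\<beta>\<in>set \<beta>s. binary_atom \<beta>" "es \<noteq> []"
  shows "prop_sat \<nu> (grounding (scott \<phi> \<beta>s) es) \<longleftrightarrow>
    models (struct_of (set es) \<nu>) (scott \<phi> \<beta>s)"
  unfolding grounding_def prop_sat_ground by (rule models_scott[symmetric]) (use assms in auto)

text \<open>Without quantifiers the universes never enter, so the two structures may have different
  domains. Fixing \<open>P\<close> and \<open>Q\<close> keeps the agreement assumption unchanged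
  throughout the induction.\<close>

lemma sat_quantifier_free_cong:
  assumes "quantifier_free \<psi>" "unary_preds \<psi> \<subseteq> P" "binary_preds \<psi> \<subseteq> Q"
    and agree: "\<And>a. atom_unary_preds a \<subseteq> P \<Longrightarrow> atom_binary_preds a \<subseteq> Q \<Longrightarrow>
      atom_true A (inst \<sigma> a) = atom_true B (inst \<sigma>' a)"
  shows "sat A \<sigma> \<psi> \<longleftrightarrow> sat B \<sigma>' \<psi>"
  using assms(1-3)
proof (induction \<psi>)
  case (Atom a)
  with agree[of a] show ?case by simp
next
  case (Conj \<psi>s)
  then have "sat A \<sigma> \<psi> \<longleftrightarrow> sat B \<sigma>' \<psi>" if "\<psi> \<in> set \<psi>s" for \<psi>
    using that by (simp add: UN_subset_iff)
  then show ?case by simp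
next
  case (Disj \<psi>s)
  then have "sat A \<sigma> \<psi> \<longleftrightarrow> sat B \<sigma>' \<psi>" if "\<psi> \<in> set \<psi>s" for \<psi>
    using that by (simp add: UN_subset_iff)
  then show ?case by simp
qed simp_all

text \<open>With quantifiers the universes must coincide, and \<open>\<sigma>\<close> varies in the
  induction while its range stays inside the universe, where the atoms agree.\<close>

lemma sat_cong:
  assumes univ: "universe A = universe B"
    and "range \<sigma> \<subseteq> universe A" "unary_preds \<psi> \<subseteq> P" "binary_preds \<psi> \<subseteq> Q"
    and agree: "\<And>a. atom_unary_preds a \<subseteq> P \<Longrightarrow> atom_binary_preds a \<subseteq> Q \<Longrightarrow>
      atom_terms a \<subseteq> universe A \<Longrightarrow> atom_true A a = atom_true B a"
  shows "sat A \<sigma> \<psi> \<longleftrightarrow> sat B \<sigma> \<psi>"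
  using assms(2-4)
proof (induction \<psi> arbitrary: \<sigma>)
  case (Atom a)
  then have "atom_terms (inst \<sigma> a) \<subseteq> universe A" by (auto simp: atom.set_map)
  with Atom agree[of "inst \<sigma> a"] show ?case by (simp add: atom.set_map)
next
  case (Conj \<psi>s)
  then have "sat A \<sigma> \<psi> \<longleftrightarrow> sat B \<sigma> \<psi>" if "\<psi> \<in> set \<psi>s" for \<psi>
    using that by (simp add: UN_subset_iff)
  then show ?case by simp
next
  case (Disj \<psi>s)
  then have "sat A \<sigma> \<psi> \<longleftrightarrow> sat B \<sigma> \<psi>" if "\<psi> \<in> set \<psi>s" for \<psi>
    using that by (simp add: UN_subset_iff)
  then show ?case by simp
next
  case (All v \<psi>)
  have "sat A (\<sigma>(v := d)) \<psi> \<longleftrightarrow> sat B (\<sigma>(v := d)) \<psi>" if "d \<in> universe A" for d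
    using that All.prems by (intro All.IH) auto
  then show ?case by (simp add: univ)
next
  case (Ex v \<psi>)
  have "sat A (\<sigma>(v := d)) \<psi> \<longleftrightarrow> sat B (\<sigma>(v := d)) \<psi>" if "d \<in> universe A" for d
    using that Ex.prems by (intro Ex.IH) auto
  then show ?case by (simp add: univ)
qed simp_all

lemma sat_rename: "quantifier_free \<psi> \<Longrightarrow> sat A \<sigma> (rename f \<psi>) \<longleftrightarrow> sat A (\<sigma> \<circ> f) \<psi>"
  by (induction \<psi>) (auto simp: atom.map_comp)

lemma scott_preds:
  "unary_preds \<phi> \<subseteq> unary_preds (scott \<phi> \<beta>s)" "binary_preds \<phi> \<subseteq> binary_preds (scott \<phi> \<beta>s)"
  by (auto simp: scott_def)

text \<open>The truth of \<open>\<phi>(x,x)\<close> depends only on the unary type of the element.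
  It holds at \<open>d\<close> in the model, hence in every structure that realises the same
  type.\<close>

lemma model_unary_type_valid:
  assumes "quantifier_free \<phi>" "\<forall>\<beta>\<in>set \<beta>s. binary_atom \<beta>"
    and "models (struct_of U \<nu>) (scott \<phi> \<beta>s)" "d \<in> U"
  shows "unary_type_at (scott \<phi> \<beta>s) \<nu> d \<in> valid_types \<phi> \<beta>s" (is "?\<tau> \<in> _")
proof -
  have "sat (struct_of U \<nu>) (case_var d d) \<phi>"
    using models_scott_matrix[OF assms(2,3)] assms(4) by simp
  moreover have "case_var d d = (\<lambda>_. d)" by (auto split: var.split)
  ultimately have sat: "sat (struct_of U \<nu>) (\<lambda>_. d) \<phi>" by simp
  have "sat A \<sigma> (rename (\<lambda>_. X) \<phi>)" if "lits_true A (inst_ty \<sigma> ?\<tau>)"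
    for A :: "('a, 'b, nat) struct" and \<sigma>
  proof -
    have "?\<tau> = unary_type_at (scott \<phi> \<beta>s) (atom_true A) (\<sigma> X)"
      using that by (simp only: lits_true_type_at)
    then have "atom_true A (inst (\<lambda>_. \<sigma> X) a) = \<nu> (inst (\<lambda>_. d) a)"
      if "atom_unary_preds a \<subseteq> unary_preds \<phi>" "atom_binary_preds a \<subseteq> binary_preds \<phi>" for a
      using that scott_preds[of \<phi> \<beta>s] by (cases a) (auto simp: unary_type_at_eq_iff)
    then have "sat A (\<lambda>_. \<sigma> X) \<phi> \<longleftrightarrow> sat (struct_of U \<nu>) (\<lambda>_. d) \<phi>"
      by (intro sat_quantifier_free_cong[OF assms(1) order.refl order.refl]) simp
    with sat show ?thesis by (simp add: sat_rename[OF assms(1)] comp_def)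
  qed
  then show ?thesis by (auto simp: valid_types_def entails_def type_at_mem)
qed

text \<open>The two unary types and the binary type together decide every atom of
  \<open>\<phi>(x,y)\<close> and \<open>\<phi>(y,x)\<close>, so the truth of both at
  \<open>c\<close>, \<open>d\<close> passes to every structure realising these types.\<close>

lemma model_binary_type_compatible:
  assumes "quantifier_free \<phi>" "\<forall>\<beta>\<in>set \<beta>s. binary_atom \<beta>"
    and "models (struct_of U \<nu>) (scott \<phi> \<beta>s)" "c \<in> U" "d \<in> U"
  shows "binary_type_at (scott \<phi> \<beta>s) \<nu> c d
    \<in> compatible_types \<phi> \<beta>s (unary_type_at (scott \<phi> \<beta>s) \<nu> c) (unary_type_at (scott \<phi> \<beta>s) \<nu> d)"
    (is "?\<pi> \<in> compatible_types _ _ ?\<tau> ?\<tau>'")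
proof -
  have "sat (struct_of U \<nu>) (case_var c d) \<phi>" "sat (struct_of U \<nu>) (case_var d c) \<phi>"
    using models_scott_matrix[OF assms(2,3)] assms(4,5) by simp_all
  moreover have "case_var d c = case_var c d \<circ> swap_var" by (auto split: var.split)
  ultimately have sat: "sat (struct_of U \<nu>) (case_var c d) \<phi>"
    "sat (struct_of U \<nu>) (case_var c d \<circ> swap_var) \<phi>" by simp_all
  have "sat A \<sigma> \<phi> \<and> sat A \<sigma> (rename swap_var \<phi>)"
    if "lits_true A (inst_ty \<sigma> (?\<tau> \<union> inst_ty (\<lambda>_. Y) ?\<tau>' \<union> ?\<pi>))"
    for A :: "('a, 'b, nat) struct" and \<sigma>
  proof -
    \<comment> \<open>The second unary type was first moved from \<open>X\<close> to
      \<open>Y\<close>; composing with \<open>\<sigma>\<close> places it at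
      \<open>\<sigma> Y\<close>.\<close>
    have "inst_ty \<sigma> (inst_ty (\<lambda>_. Y) ?\<tau>') = inst_ty (\<lambda>_. \<sigma> Y) ?\<tau>'"
      by (simp add: inst_ty_def image_image literal.map_comp atom.map_comp comp_def id_def)
    then have "lits_true A (inst_ty \<sigma> ?\<tau>)" "lits_true A (inst_ty (\<lambda>_. \<sigma> Y) ?\<tau>')"
      "lits_true A (inst_ty \<sigma> ?\<pi>)"
      using that by (auto simp: lits_true_def inst_ty_def image_Un)
    then have types: "?\<tau> = unary_type_at (scott \<phi> \<beta>s) (atom_true A) (\<sigma> X)"
      "?\<tau>' = unary_type_at (scott \<phi> \<beta>s) (atom_true A) (\<sigma> Y)"
      "?\<pi> = binary_type_at (scott \<phi> \<beta>s) (atom_true A) (\<sigma> X) (\<sigma> Y)"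
      by (simp_all only: lits_true_type_at)
    \<comment> \<open>Unary atoms and atoms with a repeated variable are decided by the type of that
      variable, mixed atoms by the binary type.\<close>
    have agree: "atom_true A (inst \<sigma> a) = \<nu> (inst (case_var c d) a)"
      if "atom_unary_preds a \<subseteq> unary_preds \<phi>" "atom_binary_preds a \<subseteq> binary_preds \<phi>" for a
    proof (cases a)
      case (UAtom P t)
      with that scott_preds[of \<phi> \<beta>s] have "P \<in> unary_preds (scott \<phi> \<beta>s)" by auto
      with UAtom types show ?thesis by (cases t) (simp_all add: unary_type_at_eq_iff)
    next
      case (BAtom R s t)
      with that scott_preds[of \<phi> \<beta>s] have "R \<in> binary_preds (scott \<phi> \<beta>s)" by auto
      with BAtom types show ?thesis
        by (cases s; cases t) (simp_all add: unary_type_at_eq_iff binary_type_at_eq_iff)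
    qed
    have "sat A \<sigma> \<phi> \<longleftrightarrow> sat (struct_of U \<nu>) (case_var c d) \<phi>"
      by (intro sat_quantifier_free_cong[OF assms(1) order.refl order.refl]) (simp add: agree)
    \<comment> \<open>Swapping the variables of an atom keeps its predicate, so the agreement above
      applies to the swapped atom.\<close>
    moreover have "atom_true A (inst (\<sigma> \<circ> swap_var) a) = \<nu> (inst (case_var c d \<circ> swap_var) a)"
      if "atom_unary_preds a \<subseteq> unary_preds \<phi>" "atom_binary_preds a \<subseteq> binary_preds \<phi>" for a
      using agree[of "inst swap_var a"] that by (simp add: atom.map_comp atom.set_map)
    then have "sat A (\<sigma> \<circ> swap_var) \<phi> \<longleftrightarrow> sat (struct_of U \<nu>) (case_var c d \<circ> swap_var) \<phi>"
      by (intro sat_quantifier_free_cong[OF assms(1) order.refl order.refl]) simp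
    ultimately show ?thesis using sat by (simp add: sat_rename[OF assms(1)])
  qed
  then show ?thesis by (auto simp: compatible_types_def entails_def type_at_mem)
qed


section \<open>The branch selected by an assignment\<close>

text \<open>The context with which stage I reaches element \<open>i\<close> on the branch selected
  by \<open>\<nu>\<close>; at \<open>i = length es + 1\<close> every element has its type.\<close>

definition unary_ctxt ::
  "('u, 'b) fm \<Rightarrow> (('u, 'b, 'e) atom \<Rightarrow> bool) \<Rightarrow> 'e list \<Rightarrow> nat \<Rightarrow> ('u, 'b, 'e) ctxt" where
  "unary_ctxt \<Gamma> \<nu> es i =
    {UTy (unary_type_at \<Gamma> \<nu> (elt es k)) (elt es k) | k. 1 \<le> k \<and> k < i}"

text \<open>The context with which stage II reaches the pair \<open>(i, j)\<close> on the branch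
  selected by \<open>\<nu>\<close>.\<close>

definition binary_ctxt ::
  "('u, 'b) fm \<Rightarrow> (('u, 'b, 'e) atom \<Rightarrow> bool) \<Rightarrow> 'e list \<Rightarrow> nat \<times> nat \<Rightarrow> ('u, 'b, 'e) ctxt" where
  "binary_ctxt \<Gamma> \<nu> es = (\<lambda>(i, j). unary_ctxt \<Gamma> \<nu> es (length es + 1) \<union>
    {BTy (binary_type_at \<Gamma> \<nu> (elt es p) (elt es q)) (elt es p) (elt es q) | p q.
      1 \<le> p \<and> p < q \<and> q \<le> length es \<and> (p < i \<or> p = i \<and> q < j)})"

lemma unary_ctxt_1: "unary_ctxt \<Gamma> \<nu> es (Suc 0) = {}"
  by (auto simp: unary_ctxt_def)

lemma unary_ctxt_step:
  "1 \<le> i \<Longrightarrow> unary_ctxt \<Gamma> \<nu> es (i + 1) =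
    insert (UTy (unary_type_at \<Gamma> \<nu> (elt es i)) (elt es i)) (unary_ctxt \<Gamma> \<nu> es i)"
  unfolding unary_ctxt_def by (force simp: less_Suc_eq)

lemma binary_ctxt_start: "binary_ctxt \<Gamma> \<nu> es (1, 2) = unary_ctxt \<Gamma> \<nu> es (length es + 1)"
  by (auto simp: binary_ctxt_def)

lemma binary_ctxt_step:
  assumes "1 \<le> i" "i < j" "j \<le> length es"
  shows "binary_ctxt \<Gamma> \<nu> es (next_pair (length es) (i, j)) =
    insert (BTy (binary_type_at \<Gamma> \<nu> (elt es i) (elt es j)) (elt es i) (elt es j))
      (binary_ctxt \<Gamma> \<nu> es (i, j))"
proof -
  \<comment> \<open>The row change needs care: after \<open>j = length es\<close> the successor is
    \<open>(i + 1, i + 2)\<close>, and no pair \<open>p < q\<close> with \<open>p = i + 1\<close>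
    has \<open>q < i + 2\<close>.\<close>
  have *: "(1 \<le> p \<and> p < q \<and> q \<le> length es \<and>
      (case next_pair (length es) (i, j) of (i', j') \<Rightarrow> p < i' \<or> p = i' \<and> q < j')) \<longleftrightarrow>
    (p = i \<and> q = j) \<or> (1 \<le> p \<and> p < q \<and> q \<le> length es \<and> (p < i \<or> p = i \<and> q < j))" for p q
    using assms by auto
  have ctxt: "binary_ctxt \<Gamma> \<nu> es ij = unary_ctxt \<Gamma> \<nu> es (length es + 1) \<union>
      {BTy (binary_type_at \<Gamma> \<nu> (elt es p) (elt es q)) (elt es p) (elt es q) | p q.
        1 \<le> p \<and> p < q \<and> q \<le> length es \<and> (case ij of (i', j') \<Rightarrow> p < i' \<or> p = i' \<and> q < j')}" for ij
    by (cases ij) (simp add: binary_ctxt_def)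
  show ?thesis unfolding ctxt[of "next_pair _ _"] * unfolding binary_ctxt_def by auto
qed

text \<open>The type recorded for an element is a function of that element, so the definite
  description has a unique value.\<close>

lemma assigned_type_binary_ctxt:
  assumes "1 \<le> k" "k \<le> length es"
  shows "assigned_type (binary_ctxt \<Gamma> \<nu> es ij) (elt es k) = unary_type_at \<Gamma> \<nu> (elt es k)"
  unfolding assigned_type_def binary_ctxt_def unary_ctxt_def
  using assms by (intro the_equality) (auto split: prod.splits)

lemma extendable_binary_ctxt:
  assumes "models (struct_of (set es) \<nu>) \<Gamma>"
  shows "extendable \<Gamma> es (binary_ctxt \<Gamma> \<nu> es ij)"
proof -
  have "lits_true (struct_of (set es) \<nu>) (ground_lits t)" if "t \<in> binary_ctxt \<Gamma> \<nu> es ij" for t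
    using that unfolding binary_ctxt_def unary_ctxt_def
    by (auto simp: lits_true_type_at split: prod.splits)
  with assms show ?thesis unfolding extendable_def by (intro exI[of _ "struct_of (set es) \<nu>"]) simp
qed

lemma extendable_mono: "extendable \<Gamma> es \<theta>' \<Longrightarrow> \<theta> \<subseteq> \<theta>' \<Longrightarrow> extendable \<Gamma> es \<theta>"
  unfolding extendable_def by blast

lemma unary_ctxt_subset: "i \<le> length es + 1 \<Longrightarrow> unary_ctxt \<Gamma> \<nu> es i \<subseteq> binary_ctxt \<Gamma> \<nu> es jk"
  by (cases jk) (auto simp: binary_ctxt_def unary_ctxt_def)

text \<open>Once \<open>i\<close> reaches \<open>length es\<close>, all unary types and all pairs
  \<open>p < q\<close> are recorded. A witness of extendability therefore agrees with
  \<open>\<nu>\<close> on every ground atom over the vocabulary of \<open>\<Gamma>\<close>.\<close>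

lemma models_if_complete_ctxt_extendable:
  assumes ext: "extendable \<Gamma> es (binary_ctxt \<Gamma> \<nu> es (i, j))" and i: "i \<ge> length es"
  shows "models (struct_of (set es) \<nu>) \<Gamma>"
proof -
  from ext obtain B where B: "universe B = set es" "models B \<Gamma>"
    "\<And>t. t \<in> binary_ctxt \<Gamma> \<nu> es (i, j) \<Longrightarrow> lits_true B (ground_lits t)"
    unfolding extendable_def by blast
  have un: "unary_type_at \<Gamma> \<nu> d = unary_type_at \<Gamma> (atom_true B) d" if "d \<in> set es" for d
  proof -
    from that obtain k where "k < length es" "d = es ! k" by (auto simp: in_set_conv_nth)
    then have "UTy (unary_type_at \<Gamma> \<nu> d) d \<in> binary_ctxt \<Gamma> \<nu> es (i, j)"
      unfolding binary_ctxt_def unary_ctxt_def by (auto intro!: exI[of _ "Suc k"])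
    from B(3)[OF this] show ?thesis by (simp add: lits_true_type_at)
  qed
  have bin: "binary_type_at \<Gamma> \<nu> (es ! p) (es ! q) = binary_type_at \<Gamma> (atom_true B) (es ! p) (es ! q)"
    if "p < q" "q < length es" for p q
  proof -
    \<comment> \<open>\<open>es ! p\<close> is the element with 1-based index \<open>Suc p\<close>;
      from \<open>Suc p < Suc q \<le> length es \<le> i\<close> the pair precedes
      \<open>(i, j)\<close>.\<close>
    have "BTy (binary_type_at \<Gamma> \<nu> (es ! p) (es ! q)) (es ! p) (es ! q) \<in> binary_ctxt \<Gamma> \<nu> es (i, j)"
      unfolding binary_ctxt_def prod.case
      by (rule UnI2, rule CollectI, rule exI[of _ "Suc p"], rule exI[of _ "Suc q"])
        (use that i in auto)
    from B(3)[OF this] show ?thesis by (simp add: lits_true_type_at)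
  qed
  have "\<nu> a = atom_true B a"
    if "atom_unary_preds a \<subseteq> unary_preds \<Gamma>" "atom_binary_preds a \<subseteq> binary_preds \<Gamma>"
      "atom_terms a \<subseteq> set es" for a
  proof (cases a)
    case (UAtom P d)
    with that un[of d] show ?thesis by (simp add: unary_type_at_eq_iff)
  next
    case (BAtom R c d)
    with that obtain p q where pq: "p < length es" "c = es ! p" "q < length es" "d = es ! q"
      by (auto simp: in_set_conv_nth)
    from BAtom that have "R \<in> binary_preds \<Gamma>" by simp
    \<comment> \<open>Equal positions are settled by the unary type. For \<open>p > q\<close> the
      type recorded for \<open>(q, p)\<close> serves, since a binary type also contains the reversed
      atoms.\<close>
    with BAtom pq un[of c] bin[of p q] bin[of q p] show ?thesis
      by (cases p q rule: linorder_cases) (auto simp: unary_type_at_eq_iff binary_type_at_eq_iff)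
  qed
  then have "sat (struct_of (set es) \<nu>) \<sigma> \<Gamma> \<longleftrightarrow> sat B \<sigma> \<Gamma>" if "range \<sigma> \<subseteq> set es" for \<sigma>
    using that B(1) by (intro sat_cong[OF _ _ order.refl order.refl]) auto
  with B(1,2) show ?thesis by (simp add: models_def)
qed


section \<open>Correctness of the two stages\<close>

lemma compatible_types_subset: "compatible_types \<phi> \<beta>s \<tau> \<tau>' \<subseteq> binary_types (scott \<phi> \<beta>s)"
  by (auto simp: compatible_types_def)

lemma valid_types_subset: "valid_types \<phi> \<beta>s \<subseteq> unary_types (scott \<phi> \<beta>s)"
  by (auto simp: valid_types_def)

text \<open>One level of either stage, with branch labels \<open>L \<tau>\<close> and continuations
  \<open>N \<tau>\<close>. The assignment falsifies every label except possibly that of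
  \<open>t\<close>, so at most one disjunct can hold.\<close>

lemma holds_branches:
  assumes "finite T" "\<forall>\<tau>\<in>T. finite (L \<tau>)"
    and sel: "\<forall>\<tau>\<in>T. (\<forall>l\<in>L \<tau>. lit_sat \<nu> l) \<longleftrightarrow> \<tau> = t"
  shows "holds \<nu> (mk_or ((\<lambda>\<tau>. mk_and {mk_and (LitN ` L \<tau>), N \<tau>}) ` T)) \<longleftrightarrow>
    t \<in> T \<and> holds \<nu> (N t)"
proof -
  have "holds \<nu> (mk_or ((\<lambda>\<tau>. mk_and {mk_and (LitN ` L \<tau>), N \<tau>}) ` T)) \<longleftrightarrow>
      (\<exists>\<tau>\<in>T. (\<forall>l\<in>L \<tau>. lit_sat \<nu> l) \<and> holds \<nu> (N \<tau>))"
    using assms(1,2) by (simp add: holds_mk_or holds_mk_and)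
  also have "\<dots> \<longleftrightarrow> (\<exists>\<tau>\<in>T. \<tau> = t \<and> holds \<nu> (N \<tau>))" using sel by simp
  finally show ?thesis by auto
qed

text \<open>One level of either stage, where \<open>f\<close> gives each atom a key. Labels have
  only key \<open>x\<close> and continuations only keys in \<open>C\<close>, so
  \<open>x \<notin> C\<close> makes the branches decomposable, and \<open>inj\<close> does this
  inside a label. Two branches true under one \<open>\<nu>\<close> would both have the type
  \<open>t \<nu>\<close>. The bound on keys is what the induction passes upwards.\<close>

lemma ddnnf_node_branches:
  assumes T: "finite T" and L: "\<forall>\<tau>\<in>T. finite (L \<tau>)" and inj: "\<forall>\<tau>\<in>T. inj_on var_of (L \<tau>)"
    and L_vars: "\<forall>\<tau>\<in>T. f ` var_of ` L \<tau> \<subseteq> {x}"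
    and N: "\<forall>\<tau>\<in>T. ddnnf_node (N \<tau>) \<and> f ` set_node (N \<tau>) \<subseteq> C"
    and fresh: "x \<notin> C"
    and sel: "\<And>\<nu>. \<forall>\<tau>\<in>T. (\<forall>l\<in>L \<tau>. lit_sat \<nu> l) \<longleftrightarrow> \<tau> = t \<nu>"
  shows "ddnnf_node (mk_or ((\<lambda>\<tau>. mk_and {mk_and (LitN ` L \<tau>), N \<tau>}) ` T)) \<and>
    f ` set_node (mk_or ((\<lambda>\<tau>. mk_and {mk_and (LitN ` L \<tau>), N \<tau>}) ` T)) \<subseteq> insert x C"
proof
  have L_node: "set_node (mk_and (LitN ` L \<tau>)) = var_of ` L \<tau>" if "\<tau> \<in> T" for \<tau>
    using L that by (auto simp: set_node_mk_and)
  show "ddnnf_node (mk_or ((\<lambda>\<tau>. mk_and {mk_and (LitN ` L \<tau>), N \<tau>}) ` T))"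
  proof (rule ddnnf_node_mk_or)
    show "ddnnf_node u" if "u \<in> (\<lambda>\<tau>. mk_and {mk_and (LitN ` L \<tau>), N \<tau>}) ` T" for u
    proof -
      from that obtain \<tau> where \<tau>: "\<tau> \<in> T" and u: "u = mk_and {mk_and (LitN ` L \<tau>), N \<tau>}" by auto
      have "ddnnf_node (mk_and (LitN ` L \<tau>))"
        using L inj \<tau>
        by (intro ddnnf_node_mk_and) (auto simp: pairwise_def inj_on_def intro: ddnnf_node.intros)
      moreover have "var_of ` L \<tau> \<inter> set_node (N \<tau>) = {}"
        using bspec[OF L_vars \<tau>] bspec[OF N \<tau>] fresh by blast
      ultimately show ?thesis
        unfolding u using bspec[OF N \<tau>] L_node[OF \<tau>]
        by (intro ddnnf_node_mk_and) (auto simp: pairwise_def)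
    qed
    show "pairwise (\<lambda>u w. \<not> (\<exists>\<nu>. holds \<nu> u \<and> holds \<nu> w))
        ((\<lambda>\<tau>. mk_and {mk_and (LitN ` L \<tau>), N \<tau>}) ` T)"
    proof (rule pairwiseI)
      fix u w
      assume "u \<in> (\<lambda>\<tau>. mk_and {mk_and (LitN ` L \<tau>), N \<tau>}) ` T"
        "w \<in> (\<lambda>\<tau>. mk_and {mk_and (LitN ` L \<tau>), N \<tau>}) ` T" "u \<noteq> w"
      then obtain \<tau> \<tau>' where \<tau>: "\<tau> \<in> T" "\<tau>' \<in> T" "\<tau> \<noteq> \<tau>'"
        and u: "u = mk_and {mk_and (LitN ` L \<tau>), N \<tau>}" and w: "w = mk_and {mk_and (LitN ` L \<tau>'), N \<tau>'}"
        by auto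
      have "\<tau> = t \<nu>" if "holds \<nu> u" for \<nu>
        using that L sel[of \<nu>] \<tau>(1) by (simp add: u holds_mk_and)
      moreover have "\<tau>' = t \<nu>" if "holds \<nu> w" for \<nu>
        using that L sel[of \<nu>] \<tau>(2) by (simp add: w holds_mk_and)
      ultimately show "\<not> (\<exists>\<nu>. holds \<nu> u \<and> holds \<nu> w)" using \<tau>(3) by blast
    qed
  qed (use T in simp)
  have "set_node (mk_or ((\<lambda>\<tau>. mk_and {mk_and (LitN ` L \<tau>), N \<tau>}) ` T)) =
      (\<Union>\<tau>\<in>T. var_of ` L \<tau> \<union> set_node (N \<tau>))"
    using T L_node by (simp add: set_node_mk_or set_node_mk_and)
  then show "f ` set_node (mk_or ((\<lambda>\<tau>. mk_and {mk_and (LitN ` L \<tau>), N \<tau>}) ` T)) \<subseteq> insert x C"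
    using L_vars N by (simp add: image_UN image_Un) blast
qed

section \<open>Separation of ground atoms between calls, followed by the value of each call\<close>

lemma distinct_elt_eq_iff:
  assumes "distinct es" "1 \<le> i" "i \<le> length es" "1 \<le> j" "j \<le> length es"
  shows "elt es i = elt es j \<longleftrightarrow> i = j"
  using assms by (subst nth_eq_iff_index_eq) auto

text \<open>A consistent set never has both literals of one variable, and \<open>f\<close> keeps
  distinct variables distinct.\<close>

lemma inj_on_var_of_map_literal:
  assumes "max_consistent V L" "inj_on f V"
  shows "inj_on var_of (map_literal f ` L)"
proof (rule inj_onI)
  fix l l' assume "l \<in> map_literal f ` L" "l' \<in> map_literal f ` L" and eq: "var_of l = var_of l'"
  then obtain k k' where k: "k \<in> L" "k' \<in> L" "l = map_literal f k" "l' = map_literal f k'" by auto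
  with eq have "var_of k = var_of k'"
    using max_consistentD(1)[OF assms(1)] assms(2) by (auto simp: inj_on_def)
  with k max_consistentD(2)[OF assms(1)] have "k = k'" by (cases k; cases k') auto
  with k show "l = l'" by simp
qed

lemma inj_on_var_of_unary_lits:
  "\<tau> \<in> unary_types \<Gamma> \<Longrightarrow> inj_on var_of (ground_lits (UTy \<tau> d))"
  unfolding ground_lits.simps inst_ty_def unary_types_def
  by (rule inj_on_var_of_map_literal) (auto simp: inj_on_def)

text \<open>For \<open>c = d\<close> the atoms \<open>R(x,y)\<close> and \<open>R(y,x)\<close> would
  become the same ground atom.\<close>

lemma inj_on_var_of_binary_lits:
  "\<pi> \<in> binary_types \<Gamma> \<Longrightarrow> c \<noteq> d \<Longrightarrow> inj_on var_of (ground_lits (BTy \<pi> c d))"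
  unfolding ground_lits.simps inst_ty_def binary_types_def
  by (rule inj_on_var_of_map_literal) (auto simp: inj_on_def)

text \<open>The pairs still to be treated when stage II stands at \<open>(i, j)\<close>, this pair
  included.\<close>

definition pairs_from :: "nat \<Rightarrow> nat \<times> nat \<Rightarrow> (nat \<times> nat) set" where
  "pairs_from n = (\<lambda>(i, j). {(p, q). 1 \<le> p \<and> p < q \<and> q \<le> n \<and> (i < p \<or> i = p \<and> j \<le> q)})"

lemma pairs_from_step:
  "1 \<le> i \<Longrightarrow> i < j \<Longrightarrow> j \<le> n \<Longrightarrow>
    pairs_from n (i, j) = insert (i, j) (pairs_from n (next_pair n (i, j))) \<and>
    (i, j) \<notin> pairs_from n (next_pair n (i, j))"
  by (auto simp: pairs_from_def)

text \<open>Induction along the recursion with an arbitrary context, since pruning branches affects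
  neither determinism nor the bound on keys. The implication on \<open>j\<close> admits the terminal
  call, whose second index exceeds \<open>length es\<close>.\<close>

lemma stage_II_ddnnf_node:
  assumes "distinct es" "1 \<le> i" "i < j" "i < length es \<longrightarrow> j \<le> length es"
  shows "ddnnf_node (stage_II \<phi> \<beta>s es (i, j) \<theta>) \<and>
    atom_terms ` set_node (stage_II \<phi> \<beta>s es (i, j) \<theta>)
      \<subseteq> (\<lambda>(p, q). {elt es p, elt es q}) ` pairs_from (length es) (i, j)"
  using assms
proof (induction \<phi> \<beta>s es "(i, j)" \<theta> arbitrary: i j rule: stage_II.induct)
  case (1 \<phi> \<beta>s es i j \<theta>)
  show ?case
  proof (cases "length es \<le> i")
    case True
    then show ?thesis by (simp add: stage_II.simps ddnnf_node.Top)
  next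
    case False
    with 1 have ij: "1 \<le> i" "i < j" "j \<le> length es" and dist: "distinct es" by auto
    let ?c = "elt es i" and ?d = "elt es j"
    let ?L = "\<lambda>\<pi>. ground_lits (BTy \<pi> ?c ?d)"
    let ?N = "\<lambda>\<pi>. stage_II \<phi> \<beta>s es (next_pair (length es) (i, j)) (insert (BTy \<pi> ?c ?d) \<theta>)"
    let ?pair = "\<lambda>(p, q). {elt es p, elt es q}"
    let ?later = "pairs_from (length es) (next_pair (length es) (i, j))"
    define T where "T = {\<pi> \<in> compatible_types \<phi> \<beta>s (assigned_type \<theta> ?c) (assigned_type \<theta> ?d).
        extendable (scott \<phi> \<beta>s) es (insert (BTy \<pi> ?c ?d) \<theta>)}"
    have T: "T \<subseteq> binary_types (scott \<phi> \<beta>s)"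
      unfolding T_def using compatible_types_subset by blast
    have fin: "finite T" "\<forall>\<pi>\<in>T. finite (?L \<pi>)"
      by (rule finite_subset[OF T finite_types(2)],
          rule ballI, rule finite_ground_lits(2)[OF subsetD[OF T]])
    have eq: "stage_II \<phi> \<beta>s es (i, j) \<theta> = mk_or ((\<lambda>\<pi>. mk_and {mk_and (LitN ` ?L \<pi>), ?N \<pi>}) ` T)"
      using False by (subst stage_II.simps) (simp only: T_def if_False)
    obtain i' j' where nxt: "next_pair (length es) (i, j) = (i', j')" by fastforce
    have IH: "\<forall>\<pi>\<in>T. ddnnf_node (?N \<pi>) \<and> atom_terms ` set_node (?N \<pi>) \<subseteq> ?pair ` ?later"
      unfolding nxt using False nxt ij dist
      by (intro ballI "1.hyps") (auto simp: T_def split: if_splits)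
    have terms_L: "\<forall>\<pi>\<in>T. atom_terms ` var_of ` ?L \<pi> \<subseteq> {?pair (i, j)}"
      using T atom_terms_binary_lits by fastforce
    have fresh: "?pair (i, j) \<notin> ?pair ` ?later"
    proof
      assume "?pair (i, j) \<in> ?pair ` ?later"
      then obtain p q where pq: "(p, q) \<in> ?later" "{?c, ?d} = {elt es p, elt es q}" by auto
      then have "1 \<le> p" "p < q" "q \<le> length es" by (auto simp: pairs_from_def split: prod.splits)
      \<comment> \<open>Distinctness leaves two ways to match the doubletons; the crossed one
        contradicts \<open>i < j\<close> and \<open>p < q\<close>.\<close>
      with pq(2) ij distinct_elt_eq_iff[OF dist] have "p = i" "q = j"
        unfolding doubleton_eq_iff by (smt (verit) less_imp_le_nat order.trans leD)+
      with pq(1) pairs_from_step[OF ij] show False by simp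
    qed
    have inj: "\<forall>\<pi>\<in>T. inj_on var_of (?L \<pi>)"
    proof (rule ballI, rule inj_on_var_of_binary_lits[OF subsetD[OF T]])
      show "?c \<noteq> ?d" using ij distinct_elt_eq_iff[OF dist, of i j] by simp
    qed
    have sel: "\<forall>\<pi>\<in>T. (\<forall>l\<in>?L \<pi>. lit_sat \<nu> l) \<longleftrightarrow> \<pi> = binary_type_at (scott \<phi> \<beta>s) \<nu> ?c ?d" for \<nu>
      by (rule ballI, rule binary_lits_sat_iff[OF subsetD[OF T]])
    have "?pair ` pairs_from (length es) (i, j) = insert (?pair (i, j)) (?pair ` ?later)"
      using pairs_from_step[OF ij] by (metis image_insert)
    then show ?thesis
      unfolding eq using ddnnf_node_branches[OF fin inj terms_L IH fresh sel] by simp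
  qed
qed

text \<open>Stage I introduces atoms with singleton keys. Stage II only adds two-element keys, as
  \<open>es\<close> is distinct, so the two stages share no variable.\<close>

lemma stage_I_ddnnf_node:
  assumes "distinct es" "1 \<le> i"
  shows "ddnnf_node (stage_I \<phi> \<beta>s es i \<theta>) \<and>
    atom_terms ` set_node (stage_I \<phi> \<beta>s es i \<theta>)
      \<subseteq> (\<lambda>p. {elt es p}) ` {i..length es} \<union>
         (\<lambda>(p, q). {elt es p, elt es q}) ` pairs_from (length es) (1, 2)"
  using assms
proof (induction \<phi> \<beta>s es i \<theta> rule: stage_I.induct)
  case (1 \<phi> \<beta>s es i \<theta>)
  let ?pairs = "(\<lambda>(p, q). {elt es p, elt es q}) ` pairs_from (length es) (1, 2)"
  show ?case
  proof (cases "length es < i")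
    case True
    \<comment> \<open>The index condition of stage II at \<open>(1, 2)\<close>; on a one-element
      domain that call is already terminal.\<close>
    have "1 < length es \<longrightarrow> 2 \<le> length es" by auto
    with stage_II_ddnnf_node[of es 1 2 \<phi> \<beta>s \<theta>] True 1 show ?thesis
      by (subst (1 2) stage_I.simps) (auto 0 3)
  next
    case False
    with 1 have i: "1 \<le> i" "i \<le> length es" and dist: "distinct es" by auto
    let ?d = "elt es i"
    let ?L = "\<lambda>\<tau>. ground_lits (UTy \<tau> ?d)"
    let ?N = "\<lambda>\<tau>. stage_I \<phi> \<beta>s es (i + 1) (insert (UTy \<tau> ?d) \<theta>)"
    define T where "T = {\<tau> \<in> valid_types \<phi> \<beta>s.
        extendable (scott \<phi> \<beta>s) es (insert (UTy \<tau> ?d) \<theta>)}"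
    have T: "T \<subseteq> unary_types (scott \<phi> \<beta>s)"
      unfolding T_def using valid_types_subset by blast
    have fin: "finite T" "\<forall>\<tau>\<in>T. finite (?L \<tau>)"
      by (rule finite_subset[OF T finite_types(1)],
          rule ballI, rule finite_ground_lits(1)[OF subsetD[OF T]])
    have eq: "stage_I \<phi> \<beta>s es i \<theta> = mk_or ((\<lambda>\<tau>. mk_and {mk_and (LitN ` ?L \<tau>), ?N \<tau>}) ` T)"
      using False by (subst stage_I.simps) (simp only: T_def if_False)
    have IH: "\<forall>\<tau>\<in>T. ddnnf_node (?N \<tau>) \<and>
        atom_terms ` set_node (?N \<tau>) \<subseteq> (\<lambda>p. {elt es p}) ` {i+1..length es} \<union> ?pairs"
      using False 1 by (intro ballI "1.IH") (auto simp: T_def)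
    have terms_L: "\<forall>\<tau>\<in>T. atom_terms ` var_of ` ?L \<tau> \<subseteq> {{?d}}"
      using T atom_terms_unary_lits by fastforce
    have "{?d} \<notin> (\<lambda>p. {elt es p}) ` {i+1..length es}"
      using i distinct_elt_eq_iff[OF dist] by auto
    moreover have "{?d} \<notin> ?pairs"
    proof
      assume "{?d} \<in> ?pairs"
      then obtain p q where "(p, q) \<in> pairs_from (length es) (1, 2)" "elt es p = elt es q"
        by auto
      with distinct_elt_eq_iff[OF dist, of p q] show False by (simp add: pairs_from_def)
    qed
    ultimately have fresh: "{?d} \<notin> (\<lambda>p. {elt es p}) ` {i+1..length es} \<union> ?pairs" by blast
    have inj: "\<forall>\<tau>\<in>T. inj_on var_of (?L \<tau>)"
      by (rule ballI, rule inj_on_var_of_unary_lits[OF subsetD[OF T]])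
    have sel: "\<forall>\<tau>\<in>T. (\<forall>l\<in>?L \<tau>. lit_sat \<nu> l) \<longleftrightarrow> \<tau> = unary_type_at (scott \<phi> \<beta>s) \<nu> ?d" for \<nu>
      by (rule ballI, rule unary_lits_sat_iff[OF subsetD[OF T]])
    have "{i..length es} = insert i {i+1..length es}" using i by auto
    then have "(\<lambda>p. {elt es p}) ` {i..length es} \<union> ?pairs
        = insert {?d} ((\<lambda>p. {elt es p}) ` {i+1..length es} \<union> ?pairs)" by simp
    then show ?thesis
      unfolding eq using ddnnf_node_branches[OF fin inj terms_L IH fresh sel] by simp
  qed
qed

text \<open>Extendability of the context is carried as an invariant because the terminal call
  returns \<open>TopN\<close> whatever \<open>\<nu>\<close> is: there the invariant itself shows
  that \<open>\<nu>\<close> describes a model. At earlier calls, the branch of \<open>\<nu>\<close>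
  either survives or, being cut off, shows that \<open>\<nu>\<close> is not a model.\<close>

lemma holds_stage_II:
  assumes "quantifier_free \<phi>" "\<forall>\<beta>\<in>set \<beta>s. binary_atom \<beta>"
    and "1 \<le> i" "i < j" "i < length es \<longrightarrow> j \<le> length es"
    and "extendable (scott \<phi> \<beta>s) es (binary_ctxt (scott \<phi> \<beta>s) \<nu> es (i, j))"
  shows "holds \<nu> (stage_II \<phi> \<beta>s es (i, j) (binary_ctxt (scott \<phi> \<beta>s) \<nu> es (i, j))) \<longleftrightarrow>
    models (struct_of (set es) \<nu>) (scott \<phi> \<beta>s)"
  using assms
proof (induction \<phi> \<beta>s es "(i, j)" "binary_ctxt (scott \<phi> \<beta>s) \<nu> es (i, j)" arbitrary: i j
    rule: stage_II.induct)
  case (1 \<phi> \<beta>s es i j)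
  let ?\<theta> = "binary_ctxt (scott \<phi> \<beta>s) \<nu> es"
  show ?case
  proof (cases "length es \<le> i")
    case True
    with models_if_complete_ctxt_extendable[OF "1.prems"(6)] show ?thesis
      by (simp add: stage_II.simps)
  next
    case False
    with 1 have ij: "1 \<le> i" "i < j" "j \<le> length es" by auto
    let ?c = "elt es i" and ?d = "elt es j" and ?\<Gamma> = "scott \<phi> \<beta>s"
    let ?L = "\<lambda>\<pi>. ground_lits (BTy \<pi> ?c ?d)"
    let ?N = "\<lambda>\<pi>. stage_II \<phi> \<beta>s es (next_pair (length es) (i, j)) (insert (BTy \<pi> ?c ?d) (?\<theta> (i, j)))"
    let ?\<pi> = "binary_type_at ?\<Gamma> \<nu> ?c ?d"
    define T where
      "T = {\<pi> \<in> compatible_types \<phi> \<beta>s (assigned_type (?\<theta> (i, j)) ?c) (assigned_type (?\<theta> (i, j)) ?d).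
        extendable ?\<Gamma> es (insert (BTy \<pi> ?c ?d) (?\<theta> (i, j)))}"
    have T: "T \<subseteq> binary_types ?\<Gamma>"
      unfolding T_def using compatible_types_subset by blast
    have fin: "finite T" "\<forall>\<pi>\<in>T. finite (?L \<pi>)"
      by (rule finite_subset[OF T finite_types(2)],
          rule ballI, rule finite_ground_lits(2)[OF subsetD[OF T]])
    have eq: "stage_II \<phi> \<beta>s es (i, j) (?\<theta> (i, j)) =
        mk_or ((\<lambda>\<pi>. mk_and {mk_and (LitN ` ?L \<pi>), ?N \<pi>}) ` T)"
      using False by (subst stage_II.simps) (simp only: T_def if_False)
    obtain i' j' where nxt: "next_pair (length es) (i, j) = (i', j')" by fastforce
    have step: "insert (BTy ?\<pi> ?c ?d) (?\<theta> (i, j)) = ?\<theta> (i', j')"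
      unfolding nxt[symmetric] by (rule binary_ctxt_step[OF ij, symmetric])
    \<comment> \<open>Membership in \<open>T\<close> includes the extendability test, which supplies
      the invariant for the next call.\<close>
    have IH: "holds \<nu> (?N ?\<pi>) \<longleftrightarrow> models (struct_of (set es) \<nu>) ?\<Gamma>" if "?\<pi> \<in> T"
    proof -
      have "extendable ?\<Gamma> es (?\<theta> (i', j'))" using that step by (simp add: T_def)
      then show ?thesis
        unfolding nxt step using that False nxt ij step "1.prems"
        by (intro "1.hyps") (auto simp: T_def split: if_splits)
    qed
    have "?\<pi> \<in> T" if mod: "models (struct_of (set es) \<nu>) ?\<Gamma>"
    proof -
      have "?\<pi> \<in> compatible_types \<phi> \<beta>s (unary_type_at ?\<Gamma> \<nu> ?c) (unary_type_at ?\<Gamma> \<nu> ?d)"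
        by (rule model_binary_type_compatible[OF "1.prems"(1,2) mod]) (use ij in auto)
      moreover have "assigned_type (?\<theta> (i, j)) ?c = unary_type_at ?\<Gamma> \<nu> ?c"
        "assigned_type (?\<theta> (i, j)) ?d = unary_type_at ?\<Gamma> \<nu> ?d"
        by (rule assigned_type_binary_ctxt; use ij in simp)+
      ultimately show ?thesis
        unfolding T_def mem_Collect_eq step using extendable_binary_ctxt[OF mod] by simp
    qed
    moreover have sel: "\<forall>\<pi>\<in>T. (\<forall>l\<in>?L \<pi>. lit_sat \<nu> l) \<longleftrightarrow> \<pi> = ?\<pi>"
      by (rule ballI, rule binary_lits_sat_iff[OF subsetD[OF T]])
    ultimately show ?thesis
      unfolding eq holds_branches[OF fin sel] using IH by blast
  qed
qed

text \<open>Extendability is demanded only at the handover to stage II. The initial empty context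
  need not be extendable: if no model exists, no branch survives the first test.\<close>

lemma holds_stage_I:
  assumes "quantifier_free \<phi>" "\<forall>\<beta>\<in>set \<beta>s. binary_atom \<beta>"
    and "1 \<le> i" "i \<le> length es + 1"
    and "i \<le> length es \<or> extendable (scott \<phi> \<beta>s) es (unary_ctxt (scott \<phi> \<beta>s) \<nu> es i)"
  shows "holds \<nu> (stage_I \<phi> \<beta>s es i (unary_ctxt (scott \<phi> \<beta>s) \<nu> es i)) \<longleftrightarrow>
    models (struct_of (set es) \<nu>) (scott \<phi> \<beta>s)"
  using assms
proof (induction \<phi> \<beta>s es i "unary_ctxt (scott \<phi> \<beta>s) \<nu> es i" rule: stage_I.induct)
  case (1 \<phi> \<beta>s es i)
  let ?\<Gamma> = "scott \<phi> \<beta>s"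
  let ?\<theta> = "unary_ctxt ?\<Gamma> \<nu> es"
  show ?case
  proof (cases "length es < i")
    case True
    with "1.prems" have i: "i = length es + 1" by simp
    have "1 < length es \<longrightarrow> 2 \<le> length es" by auto
    with holds_stage_II[OF "1.prems"(1,2), of 1 2 es \<nu>] "1.prems"(5) i show ?thesis
      by (subst stage_I.simps) (simp add: binary_ctxt_start[simplified])
  next
    case False
    with "1.prems" have i: "1 \<le> i" "i \<le> length es" by auto
    let ?d = "elt es i"
    let ?L = "\<lambda>\<tau>. ground_lits (UTy \<tau> ?d)"
    let ?N = "\<lambda>\<tau>. stage_I \<phi> \<beta>s es (i + 1) (insert (UTy \<tau> ?d) (?\<theta> i))"
    let ?\<tau> = "unary_type_at ?\<Gamma> \<nu> ?d"
    define T where "T = {\<tau> \<in> valid_types \<phi> \<beta>s. extendable ?\<Gamma> es (insert (UTy \<tau> ?d) (?\<theta> i))}"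
    have T: "T \<subseteq> unary_types ?\<Gamma>"
      unfolding T_def using valid_types_subset by blast
    have fin: "finite T" "\<forall>\<tau>\<in>T. finite (?L \<tau>)"
      by (rule finite_subset[OF T finite_types(1)],
          rule ballI, rule finite_ground_lits(1)[OF subsetD[OF T]])
    have eq: "stage_I \<phi> \<beta>s es i (?\<theta> i) = mk_or ((\<lambda>\<tau>. mk_and {mk_and (LitN ` ?L \<tau>), ?N \<tau>}) ` T)"
      using False by (subst stage_I.simps) (simp only: T_def if_False)
    have step: "insert (UTy ?\<tau> ?d) (?\<theta> i) = ?\<theta> (i + 1)"
      by (rule unary_ctxt_step[OF i(1), symmetric])
    have IH: "holds \<nu> (?N ?\<tau>) \<longleftrightarrow> models (struct_of (set es) \<nu>) ?\<Gamma>" if "?\<tau> \<in> T"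
    proof -
      have "extendable ?\<Gamma> es (?\<theta> (i + 1))" using that step by (simp add: T_def)
      then show ?thesis
        unfolding step using that False i step "1.prems"(1,2)
        by (intro "1.hyps") (auto simp: T_def)
    qed
    have "?\<tau> \<in> T" if mod: "models (struct_of (set es) \<nu>) ?\<Gamma>"
    proof -
      \<comment> \<open>The model satisfies all of its induced types, and this context is a subset
        of them.\<close>
      have "extendable ?\<Gamma> es (?\<theta> (i + 1))"
        using extendable_mono[OF extendable_binary_ctxt[OF mod] unary_ctxt_subset] i by simp
      moreover have "?\<tau> \<in> valid_types \<phi> \<beta>s"
        by (rule model_unary_type_valid[OF "1.prems"(1,2) mod]) (use i in auto)
      ultimately show ?thesis unfolding T_def mem_Collect_eq step by simp
    qed
    moreover have sel: "\<forall>\<tau>\<in>T. (\<forall>l\<in>?L \<tau>. lit_sat \<nu> l) \<longleftrightarrow> \<tau> = ?\<tau>"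
      by (rule ballI, rule unary_lits_sat_iff[OF subsetD[OF T]])
    ultimately show ?thesis
      unfolding eq holds_branches[OF fin sel] using IH by blast
  qed
qed

theorem theorem9:
  fixes \<phi> :: "('u, 'b) fm" and \<beta>s :: "('u, 'b, var) atom list" and es :: "'e list"
  assumes "quantifier_free \<phi>"
    and "\<forall>\<beta>\<in>set \<beta>s. binary_atom \<beta>"
    and "distinct es" and "es \<noteq> []"
  shows "d_DNNF (two_stage \<phi> \<beta>s es) \<and>
         encodes (two_stage \<phi> \<beta>s es) (grounding (scott \<phi> \<beta>s) es)"
proof
  show "d_DNNF (two_stage \<phi> \<beta>s es)"
    unfolding two_stage_def using assms stage_I_ddnnf_node
    by (intro d_DNNF_circuit_of) blast
  have "holds \<nu> (stage_I \<phi> \<beta>s es 1 {}) \<longleftrightarrow> models (struct_of (set es) \<nu>) (scott \<phi> \<beta>s)" for \<nu>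
    \<comment> \<open>As \<open>es\<close> is nonempty, \<open>1 \<le> length es\<close> discharges
      the condition on extendability at the first call.\<close>
    using holds_stage_I[OF assms(1,2), of 1 es \<nu>] assms(4) by (simp add: unary_ctxt_1 Suc_le_eq)
  then show "encodes (two_stage \<phi> \<beta>s es) (grounding (scott \<phi> \<beta>s) es)"
    using prop_sat_grounding[OF assms(2,4)]
    by (simp add: encodes_def two_stage_def circuit_of_sel node_sat_circuit_of)
qed

end
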